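(* Let $S$ be an $E$-solid locally inverse semigroup and $\rho$ an inverse semigroup congruence on $S$ such that each idempotent $\rho$-class (i.e. each class $e\rho$ with $e$ an idempotent of $S$), regarded as a subsemigroup of $S$, is a completely simple semigroup. Then there exist a completely simple semigroup $K$ and an action of the inverse semigroup $T=S/\rho$ on $K$ by endomorphisms on the left such that the extension $(S,\rho)$ can be embedded into the $\lambda$-semidirect product extension $(K\rtimes_\lambda T,\vartheta_2)$; that is, there is an injective homomorphism $\psi\colon S\to K\rtimes_\lambda T$ such that the congruence on $S$ induced by $\psi\vartheta_2^\natural$ (equivalently, by $\psi$ followed by the second projection onto $T$) is exactly $\rho$.
   Context: A semigroup is locally inverse if it is regular and every local submonoid $eSe$ ($e$ idempotent) is an inverse semigroup. A semigroup is $E$-solid if the subsemigroup generated by its idempotents is completely regular. A congruence $\rho$ on $S$ is an inverse semigroup congruence if $S/\rho$ is an inverse semigroup. An extension by an inverse semigroup is a pair $(S,\rho)$ with $\rho$ an inverse semigroup congruence on $S$. If $(S,\rho)$ and $(U,\sigma)$ are such extensions, an embedding of $(S,\rho)$ into $(U,\sigma)$ is an injective homomorphism $\psi\colon S\to U$ such that the kernel of $\psi\sigma^\natural$ equals $\rho$. Let $K$ be a semigroup and $T$ an inverse semigroup; $T$ acts on $K$ (by endomorphisms on the left) if an antihomomorphism $t\mapsto\varepsilon_t$ from $T$ to the endomorphism monoid of $K$ is given (so $\varepsilon_u\varepsilon_t=\varepsilon_{tu}$, maps written on the right); write ${}^t a$ for $a\varepsilon_t$. The $\lambda$-semidirect product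 $K\rtimes_\lambda T$ is the set $\{(a,t)\in K\times T: {}^{tt^{-1}}a=a\}$ with multiplication $(a,t)(b,u)=({}^{(tu)(tu)^{-1}}a\cdot {}^t b,\ tu)$. The $\lambda$-semidirect product extension of $K$ by $T$ is the pair $(K\rtimes_\lambda T,\vartheta_2)$ where $\vartheta_2$ is the congruence induced by the second projection $(a,t)\mapsto t$. *)

theory Defs
  imports Main
begin

definition semigroup :: "'a set \<Rightarrow> ('a \<Rightarrow> 'a \<Rightarrow> 'a) \<Rightarrow> bool" where
  "semigroup S m \<longleftrightarrow> (\<forall>x\<in>S. \<forall>y\<in>S. m x y \<in> S) \<and>
     (\<forall>x\<in>S. \<forall>y\<in>S. \<forall>z\<in>S. m (m x y) z = m x (m y z))"

definition idem :: "('a \<Rightarrow> 'a \<Rightarrow> 'a) \<Rightarrow> 'a \<Rightarrow> bool" where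
  "idem m e \<longleftrightarrow> m e e = e"

definition idempotents :: "'a set \<Rightarrow> ('a \<Rightarrow> 'a \<Rightarrow> 'a) \<Rightarrow> 'a set" where
  "idempotents S m = {e\<in>S. idem m e}"

definition is_inverse :: "'a set \<Rightarrow> ('a \<Rightarrow> 'a \<Rightarrow> 'a) \<Rightarrow> 'a \<Rightarrow> 'a \<Rightarrow> bool" where
  "is_inverse S m a b \<longleftrightarrow> b \<in> S \<and> m (m a b) a = a \<and> m (m b a) b = b"

definition regular :: "'a set \<Rightarrow> ('a \<Rightarrow> 'a \<Rightarrow> 'a) \<Rightarrow> bool" where
  "regular S m \<longleftrightarrow> semigroup S m \<and> (\<forall>a\<in>S. \<exists>x\<in>S. m (m a x) a = a)"

definition inverse_semigroup :: "'a set \<Rightarrow> ('a \<Rightarrow> 'a \<Rightarrow> 'a) \<Rightarrow> bool" where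
  "inverse_semigroup S m \<longleftrightarrow> semigroup S m \<and> (\<forall>a\<in>S. \<exists>!b. is_inverse S m a b)"

definition sinv :: "'a set \<Rightarrow> ('a \<Rightarrow> 'a \<Rightarrow> 'a) \<Rightarrow> 'a \<Rightarrow> 'a" where
  "sinv S m a = (THE b. is_inverse S m a b)"

definition local_submonoid :: "'a set \<Rightarrow> ('a \<Rightarrow> 'a \<Rightarrow> 'a) \<Rightarrow> 'a \<Rightarrow> 'a set" where
  "local_submonoid S m e = {m (m e s) e | s. s \<in> S}"

definition locally_inverse :: "'a set \<Rightarrow> ('a \<Rightarrow> 'a \<Rightarrow> 'a) \<Rightarrow> bool" where
  "locally_inverse S m \<longleftrightarrow> regular S m \<and>
     (\<forall>e\<in>idempotents S m. inverse_semigroup (local_submonoid S m e) m)"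

definition subsemigroup :: "'a set \<Rightarrow> 'a set \<Rightarrow> ('a \<Rightarrow> 'a \<Rightarrow> 'a) \<Rightarrow> bool" where
  "subsemigroup A S m \<longleftrightarrow> A \<subseteq> S \<and> (\<forall>x\<in>A. \<forall>y\<in>A. m x y \<in> A)"

definition generated :: "'a set \<Rightarrow> ('a \<Rightarrow> 'a \<Rightarrow> 'a) \<Rightarrow> 'a set \<Rightarrow> 'a set" where
  "generated S m X = \<Inter> {A. subsemigroup A S m \<and> X \<subseteq> A}"

definition subgroup_of :: "'a set \<Rightarrow> 'a set \<Rightarrow> ('a \<Rightarrow> 'a \<Rightarrow> 'a) \<Rightarrow> bool" where
  "subgroup_of G S m \<longleftrightarrow> subsemigroup G S m \<and>
     (\<exists>e\<in>G. (\<forall>g\<in>G. m e g = g \<and> m g e = g) \<and> (\<forall>g\<in>G. \<exists>h\<in>G. m g h = e \<and> m h g = e))"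

definition completely_regular :: "'a set \<Rightarrow> ('a \<Rightarrow> 'a \<Rightarrow> 'a) \<Rightarrow> bool" where
  "completely_regular S m \<longleftrightarrow> semigroup S m \<and> (\<forall>a\<in>S. \<exists>G. subgroup_of G S m \<and> a \<in> G)"

definition E_solid :: "'a set \<Rightarrow> ('a \<Rightarrow> 'a \<Rightarrow> 'a) \<Rightarrow> bool" where
  "E_solid S m \<longleftrightarrow> completely_regular (generated S m (idempotents S m)) m"

definition ideal :: "'a set \<Rightarrow> 'a set \<Rightarrow> ('a \<Rightarrow> 'a \<Rightarrow> 'a) \<Rightarrow> bool" where
  "ideal I S m \<longleftrightarrow> I \<subseteq> S \<and> I \<noteq> {} \<and> (\<forall>s\<in>S. \<forall>x\<in>I. m s x \<in> I \<and> m x s \<in> I)"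

definition simple :: "'a set \<Rightarrow> ('a \<Rightarrow> 'a \<Rightarrow> 'a) \<Rightarrow> bool" where
  "simple S m \<longleftrightarrow> semigroup S m \<and> (\<forall>I. ideal I S m \<longrightarrow> I = S)"

definition primitive_idempotent :: "'a set \<Rightarrow> ('a \<Rightarrow> 'a \<Rightarrow> 'a) \<Rightarrow> 'a \<Rightarrow> bool" where
  "primitive_idempotent S m e \<longleftrightarrow> e \<in> idempotents S m \<and>
     (\<forall>f\<in>idempotents S m. m e f = f \<and> m f e = f \<longrightarrow> f = e)"

definition completely_simple :: "'a set \<Rightarrow> ('a \<Rightarrow> 'a \<Rightarrow> 'a) \<Rightarrow> bool" where
  "completely_simple S m \<longleftrightarrow> simple S m \<and> (\<exists>e. primitive_idempotent S m e)"

definition congruence :: "'a set \<Rightarrow> ('a \<Rightarrow> 'a \<Rightarrow> 'a) \<Rightarrow> ('a \<times> 'a) set \<Rightarrow> bool" where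
  "congruence S m r \<longleftrightarrow> equiv S r \<and>
     (\<forall>a b c. (a, b) \<in> r \<longrightarrow> c \<in> S \<longrightarrow> (m c a, m c b) \<in> r \<and> (m a c, m b c) \<in> r)"

definition quot_mult :: "('a \<times> 'a) set \<Rightarrow> ('a \<Rightarrow> 'a \<Rightarrow> 'a) \<Rightarrow> 'a set \<Rightarrow> 'a set \<Rightarrow> 'a set" where
  "quot_mult r m X Y = r `` {m (SOME x. x \<in> X) (SOME y. y \<in> Y)}"

definition inverse_congruence :: "'a set \<Rightarrow> ('a \<Rightarrow> 'a \<Rightarrow> 'a) \<Rightarrow> ('a \<times> 'a) set \<Rightarrow> bool" where
  "inverse_congruence S m r \<longleftrightarrow> congruence S m r \<and> inverse_semigroup (S // r) (quot_mult r m)"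

text \<open>Left action of T on K by endomorphisms: t \<mapsto> eps t, with eps (t u) = eps t \<circ> eps u
  (i.e. the antihomomorphism into End(K) with maps written on the right).\<close>
definition endomorphism :: "'k set \<Rightarrow> ('k \<Rightarrow> 'k \<Rightarrow> 'k) \<Rightarrow> ('k \<Rightarrow> 'k) \<Rightarrow> bool" where
  "endomorphism K mK f \<longleftrightarrow> (\<forall>a\<in>K. f a \<in> K) \<and> (\<forall>a\<in>K. \<forall>b\<in>K. f (mK a b) = mK (f a) (f b))"

definition left_action ::
  "'t set \<Rightarrow> ('t \<Rightarrow> 't \<Rightarrow> 't) \<Rightarrow> 'k set \<Rightarrow> ('k \<Rightarrow> 'k \<Rightarrow> 'k) \<Rightarrow> ('t \<Rightarrow> 'k \<Rightarrow> 'k) \<Rightarrow> bool" where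
  "left_action T mT K mK eps \<longleftrightarrow>
     (\<forall>t\<in>T. endomorphism K mK (eps t)) \<and>
     (\<forall>t\<in>T. \<forall>u\<in>T. \<forall>a\<in>K. eps (mT t u) a = eps t (eps u a))"

definition lsd_carrier ::
  "'k set \<Rightarrow> 't set \<Rightarrow> ('t \<Rightarrow> 't \<Rightarrow> 't) \<Rightarrow> ('t \<Rightarrow> 'k \<Rightarrow> 'k) \<Rightarrow> ('k \<times> 't) set" where
  "lsd_carrier K T mT eps = {(a, t). a \<in> K \<and> t \<in> T \<and> eps (mT t (sinv T mT t)) a = a}"

definition lsd_mult ::
  "('k \<Rightarrow> 'k \<Rightarrow> 'k) \<Rightarrow> 't set \<Rightarrow> ('t \<Rightarrow> 't \<Rightarrow> 't) \<Rightarrow> ('t \<Rightarrow> 'k \<Rightarrow> 'k)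
     \<Rightarrow> 'k \<times> 't \<Rightarrow> 'k \<times> 't \<Rightarrow> 'k \<times> 't" where
  "lsd_mult mK T mT eps p q =
     (let a = fst p; t = snd p; b = fst q; u = snd q; tu = mT t u
      in (mK (eps (mT tu (sinv T mT tu)) a) (eps t b), tu))"

end

theory Submission
  imports Defs "HOL-Library.FuncSet"
begin

text \<open>
  Let \<open>T = S / \<rho>\<close> and let \<open>\<pi>\<close> be the projection. The derived category has the elements of \<open>T\<close> as
  objects and an arrow \<open>z \<rightarrow> z t\<close> for every \<open>a \<in> S\<close> with \<open>\<pi> a = t\<close> and \<open>z t t\<inverse> = z\<close>; its connected
  components are the \<open>\<R>\<close>-classes of \<open>T\<close>. Mapping this category into a completely simple semigroup
  \<open>L\<close> is all that is needed: the functions \<open>T \<rightarrow> L\<close> form a completely simple semigroup \<open>K\<close> on which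
  \<open>T\<close> acts by \<open>({}\<^sup>t f) x = f (x t)\<close>, no equivariance being required of the map into \<open>L\<close>.

  On the \<open>\<R>\<close>-class of an idempotent \<open>e\<close>, fix an idempotent \<open>\<epsilon>\<close> over \<open>e\<close> and the group
  \<open>N = \<epsilon> (e\<rho>) \<epsilon>\<close>. The restriction of an arrow \<open>a\<close> to \<open>z\<close> factors as \<open>w n v\<close> with \<open>n \<in> N\<close> and \<open>w\<close>,
  \<open>v\<close> representatives of \<open>N\<close>-orbits, and \<open>(w, n, v)\<close> are the coordinates of \<open>a\<close> in a Rees matrix
  semigroup over \<open>N\<close> with sandwich entries \<open>v w\<close>. Local inverseness guarantees that \<open>v\<close> depends only
  on the last factor of a composite arrow and \<open>w\<close> only on the first. The product over all \<open>e\<close>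
  yields \<open>L\<close>.
\<close>

section \<open>Inverse semigroups\<close>

locale inverse_sgp =
  fixes T :: "'t set" and mT :: "'t \<Rightarrow> 't \<Rightarrow> 't" (infixl "\<odot>" 70)
  assumes inverse_sgp: "inverse_semigroup T (\<odot>)"
begin

definition inv :: "'t \<Rightarrow> 't" where "inv = sinv T (\<odot>)"

lemma T_closed [simp]: "x \<in> T \<Longrightarrow> y \<in> T \<Longrightarrow> x \<odot> y \<in> T"
  and T_assoc [simp]: "x \<in> T \<Longrightarrow> y \<in> T \<Longrightarrow> z \<in> T \<Longrightarrow> x \<odot> y \<odot> z = x \<odot> (y \<odot> z)"
  using inverse_sgp by (auto simp: inverse_semigroup_def semigroup_def)

lemma inverse_unique:
  assumes "a \<in> T" "is_inverse T (\<odot>) a b" "is_inverse T (\<odot>) a c"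
  shows "b = c"
  using assms inverse_sgp unfolding inverse_semigroup_def by blast

lemma inv_is_inverse: "x \<in> T \<Longrightarrow> is_inverse T (\<odot>) x (inv x)"
  using inverse_sgp unfolding inverse_semigroup_def inv_def sinv_def by (metis theI')

lemma inv_closed [simp]: "x \<in> T \<Longrightarrow> inv x \<in> T"
  using inv_is_inverse by (auto simp: is_inverse_def)

lemma inv_mult1 [simp]: "x \<in> T \<Longrightarrow> x \<odot> (inv x \<odot> x) = x"
  and inv_mult2 [simp]: "x \<in> T \<Longrightarrow> inv x \<odot> (x \<odot> inv x) = inv x"
  using inv_is_inverse[of x] by (auto simp: is_inverse_def)

lemma inv_eqI:
  "x \<in> T \<Longrightarrow> y \<in> T \<Longrightarrow> x \<odot> (y \<odot> x) = x \<Longrightarrow> y \<odot> (x \<odot> y) = y \<Longrightarrow> inv x = y"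
  using inverse_unique[OF _ inv_is_inverse, of x y] by (simp add: is_inverse_def)

lemma inv_inv [simp]: "x \<in> T \<Longrightarrow> inv (inv x) = x"
  by (rule inv_eqI) auto

lemma inv_idem: "e \<in> T \<Longrightarrow> e \<odot> e = e \<Longrightarrow> inv e = e"
  by (rule inv_eqI) auto

text \<open>Let \<open>x\<close> be the inverse of \<open>e \<odot> f\<close>. Then
  \<open>f \<odot> x \<odot> e\<close> is also an inverse of \<open>e \<odot> f\<close>, hence
  equals \<open>x\<close>, and it is idempotent because
  \<open>x \<odot> (e \<odot> f) \<odot> x = x\<close>. An idempotent is its own inverse, so
  \<open>x = e \<odot> f\<close>.\<close>

lemma idem_mult:
  assumes e: "e \<in> T" "e \<odot> e = e" and f: "f \<in> T" "f \<odot> f = f"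
  shows "e \<odot> f \<odot> (e \<odot> f) = e \<odot> f"
proof -
  define x where "x = inv (e \<odot> f)"
  have x: "x \<in> T" using e f by (simp add: x_def)
  have "(e \<odot> f) \<odot> (x \<odot> (e \<odot> f)) = e \<odot> f" "x \<odot> ((e \<odot> f) \<odot> x) = x"
    using e f by (simp_all add: x_def del: T_assoc)
  then have 1: "e \<odot> (f \<odot> (x \<odot> (e \<odot> f))) = e \<odot> f" "x \<odot> (e \<odot> (f \<odot> x)) = x"
    using e f x by simp_all
  have ee: "e \<odot> (e \<odot> y) = e \<odot> y" and ff: "f \<odot> (f \<odot> y) = f \<odot> y" if "y \<in> T" for y
    using that e f by (metis T_assoc)+
  have "inv (e \<odot> f) = f \<odot> x \<odot> e"
  proof (rule inv_eqI)
    have "x \<odot> (e \<odot> (f \<odot> (x \<odot> e))) = x \<odot> e"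
      using 1(2) e f x by (metis T_assoc T_closed)
    then show "f \<odot> x \<odot> e \<odot> (e \<odot> f \<odot> (f \<odot> x \<odot> e)) = f \<odot> x \<odot> e"
      using e f x ee ff by simp
  qed (use e f x 1 ee ff in simp_all)
  then have "x = f \<odot> x \<odot> e" by (simp add: x_def)
  then have "x \<odot> x = x"
    using 1(2) e f x by (metis T_assoc T_closed)
  then have "e \<odot> f = x"
    using inv_idem[of x] x e f inv_inv[of "e \<odot> f"] by (simp add: x_def)
  with \<open>x \<odot> x = x\<close> show ?thesis by simp
qed

text \<open>Both products are idempotent, which makes \<open>f \<odot> e\<close> an inverse of
  \<open>e \<odot> f\<close>; but \<open>e \<odot> f\<close> is inverse to itself, and inverses are
  unique.\<close>

lemma idem_commute:
  assumes e: "e \<in> T" "e \<odot> e = e" and f: "f \<in> T" "f \<odot> f = f"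
  shows "e \<odot> f = f \<odot> e"
proof -
  have ee: "e \<odot> (e \<odot> y) = e \<odot> y" and ff: "f \<odot> (f \<odot> y) = f \<odot> y" if "y \<in> T" for y
    using that e f by (metis T_assoc)+
  have "e \<odot> (f \<odot> (e \<odot> f)) = e \<odot> f" "f \<odot> (e \<odot> (f \<odot> e)) = f \<odot> e"
    using idem_mult[OF e f] idem_mult[OF f e] e f by simp_all
  then have "inv (e \<odot> f) = f \<odot> e"
    using e f ee ff by (intro inv_eqI) simp_all
  moreover have "inv (e \<odot> f) = e \<odot> f"
    using e f idem_mult[OF e f] by (intro inv_idem) simp_all
  ultimately show ?thesis by simp
qed

lemma inv_mult_distrib:
  assumes x: "x \<in> T" and y: "y \<in> T"
  shows "inv (x \<odot> y) = inv y \<odot> inv x"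
proof (rule inv_eqI)
  have c: "(y \<odot> inv y) \<odot> (inv x \<odot> x) = (inv x \<odot> x) \<odot> (y \<odot> inv y)"
    using x y by (intro idem_commute) auto
  have "x \<odot> y \<odot> (inv y \<odot> inv x \<odot> (x \<odot> y)) = x \<odot> ((y \<odot> inv y) \<odot> (inv x \<odot> x)) \<odot> y"
    using x y by simp
  also have "\<dots> = x \<odot> (inv x \<odot> x) \<odot> (y \<odot> (inv y \<odot> y))"
    unfolding c using x y by (simp del: inv_mult1)
  finally show "x \<odot> y \<odot> (inv y \<odot> inv x \<odot> (x \<odot> y)) = x \<odot> y"
    using x y by (simp del: T_assoc)
  have "inv y \<odot> inv x \<odot> (x \<odot> y \<odot> (inv y \<odot> inv x)) =
      inv y \<odot> ((inv x \<odot> x) \<odot> (y \<odot> inv y)) \<odot> inv x"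
    using x y by simp
  also have "\<dots> = inv y \<odot> (y \<odot> inv y) \<odot> (inv x \<odot> (x \<odot> inv x))"
    unfolding c[symmetric] using x y by (simp del: inv_mult2)
  finally show "inv y \<odot> inv x \<odot> (x \<odot> y \<odot> (inv y \<odot> inv x)) = inv y \<odot> inv x"
    using x y by (simp del: T_assoc)
qed (use x y in auto)

end

text \<open>Reversing the product preserves the relation of being inverse, so one-sided results
  carry over to the other side with the same map \<open>inv\<close>.\<close>

lemma inverse_sgp_opp:
  assumes "inverse_sgp T mT"
  shows "inverse_sgp T (\<lambda>x y. mT y x)"
    and "x \<in> T \<Longrightarrow> inverse_sgp.inv T (\<lambda>x y. mT y x) x = inverse_sgp.inv T mT x"
proof -
  interpret inverse_sgp T mT by fact
  have eq: "is_inverse T (\<lambda>x y. mT y x) a = is_inverse T mT a" if "a \<in> T" for a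
    using that by (auto simp: is_inverse_def fun_eq_iff)
  show 1: "inverse_sgp T (\<lambda>x y. mT y x)"
    using inverse_sgp eq
    by (auto simp: inverse_sgp_def inverse_semigroup_def semigroup_def)
  show "inverse_sgp.inv T (\<lambda>x y. mT y x) x = inverse_sgp.inv T mT x" if "x \<in> T"
    using eq[OF that] by (simp add: inverse_sgp.inv_def[OF 1] inv_def sinv_def)
qed

section \<open>Completely simple semigroups\<close>

definition group_on :: "'g set \<Rightarrow> ('g \<Rightarrow> 'g \<Rightarrow> 'g) \<Rightarrow> 'g \<Rightarrow> bool" where
  "group_on G mul u \<longleftrightarrow> semigroup G mul \<and> u \<in> G \<and> (\<forall>g\<in>G. mul u g = g \<and> mul g u = g) \<and>
     (\<forall>g\<in>G. \<exists>h\<in>G. mul g h = u \<and> mul h g = u)"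

lemma group_on_PiE:
  assumes "\<And>i. i \<in> I \<Longrightarrow> group_on (G i) mul (u i)"
  shows "group_on (PiE I G) (\<lambda>f g. \<lambda>i\<in>I. mul (f i) (g i)) (\<lambda>i\<in>I. u i)"
  unfolding group_on_def
proof (intro conjI ballI)
  show "semigroup (PiE I G) (\<lambda>f g. \<lambda>i\<in>I. mul (f i) (g i))"
    using assms unfolding group_on_def semigroup_def
    by (auto simp: PiE_mem intro!: restrict_ext)
  show "(\<lambda>i\<in>I. u i) \<in> PiE I G"
    using assms by (auto simp: group_on_def)
next
  fix f assume f: "f \<in> PiE I G"
  have 1: "mul (u i) (f i) = f i" "mul (f i) (u i) = f i" if "i \<in> I" for i
    using assms[OF that] PiE_mem[OF f that] by (auto simp: group_on_def)
  show "(\<lambda>i\<in>I. mul ((\<lambda>i\<in>I. u i) i) (f i)) = f"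
    by (rule PiE_ext[OF _ f]) (use f 1 in \<open>auto simp: PiE_mem\<close>)
  show "(\<lambda>i\<in>I. mul (f i) ((\<lambda>i\<in>I. u i) i)) = f"
    by (rule PiE_ext[OF _ f]) (use f 1 in \<open>auto simp: PiE_mem\<close>)
  have "\<forall>i\<in>I. \<exists>h\<in>G i. mul (f i) h = u i \<and> mul h (f i) = u i"
    using assms PiE_mem[OF f] by (auto simp: group_on_def)
  then obtain h where h: "\<forall>i\<in>I. h i \<in> G i \<and> mul (f i) (h i) = u i \<and> mul (h i) (f i) = u i"
    by metis
  then show "\<exists>h\<in>PiE I G. (\<lambda>i\<in>I. mul (f i) (h i)) = (\<lambda>i\<in>I. u i) \<and> (\<lambda>i\<in>I. mul (h i) (f i)) = (\<lambda>i\<in>I. u i)"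
    by (intro bexI[of _ "restrict h I"]) (auto intro!: restrict_ext)
qed

definition rees :: "('g \<Rightarrow> 'g \<Rightarrow> 'g) \<Rightarrow> ('b \<Rightarrow> 'a \<Rightarrow> 'g) \<Rightarrow> 'a \<times> 'g \<times> 'b \<Rightarrow> 'a \<times> 'g \<times> 'b \<Rightarrow> 'a \<times> 'g \<times> 'b"
  where "rees mul q = (\<lambda>(a, g, b) (a', g', b'). (a, mul (mul g (q b a')) g', b'))"

text \<open>Sandwich entries are invertible, so any element of an ideal can be moved to any other
  element. An idempotent below \<open>(a, h, b)\<close> has the same outer coordinates, and its
  middle one must be the inverse of \<open>q b a\<close>.\<close>

lemma completely_simple_rees:
  assumes G: "group_on G mul u" and A: "A \<noteq> {}" and B: "B \<noteq> {}"
    and q: "\<And>b a. b \<in> B \<Longrightarrow> a \<in> A \<Longrightarrow> q b a \<in> G"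
  shows "completely_simple (A \<times> G \<times> B) (rees mul q)"
proof -
  have cl [simp]: "mul x y \<in> G" if "x \<in> G" "y \<in> G" for x y
    using G that by (auto simp: group_on_def semigroup_def)
  have as [simp]: "mul (mul x y) z = mul x (mul y z)" if "x \<in> G" "y \<in> G" "z \<in> G" for x y z
    using G that by (auto simp: group_on_def semigroup_def)
  have u [simp]: "u \<in> G" "\<And>x. x \<in> G \<Longrightarrow> mul u x = x" "\<And>x. x \<in> G \<Longrightarrow> mul x u = x"
    using G by (auto simp: group_on_def)
  have iv: "\<exists>y\<in>G. mul x y = u \<and> mul y x = u" if "x \<in> G" for x
    using G that by (auto simp: group_on_def)
  note q [simp]
  have sg: "semigroup (A \<times> G \<times> B) (rees mul q)"
    by (auto simp: semigroup_def rees_def)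
  have "I = A \<times> G \<times> B" if I: "ideal I (A \<times> G \<times> B) (rees mul q)" for I
  proof
    show "I \<subseteq> A \<times> G \<times> B" using I by (simp add: ideal_def)
    show "A \<times> G \<times> B \<subseteq> I"
    proof
      fix y assume "y \<in> A \<times> G \<times> B"
      then obtain a' g' b' where y: "y = (a', g', b')" "a' \<in> A" "g' \<in> G" "b' \<in> B" by auto
      obtain a g b where x: "(a, g, b) \<in> I" "a \<in> A" "g \<in> G" "b \<in> B"
        using I unfolding ideal_def by fastforce
      \<comment> \<open>\<open>h\<close> cancels the middle factor that arises when
        \<open>(a, g, b)\<close> is multiplied from both sides below.\<close>
      obtain h where h: "h \<in> G" "mul h (mul (q b a) (mul g (q b a))) = u"
        using iv[of "mul (q b a) (mul g (q b a))"] x by auto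
      have "rees mul q (a', mul g' h, b) (a, g, b) \<in> I"
        using I x y h unfolding ideal_def by auto
      then have "rees mul q (rees mul q (a', mul g' h, b) (a, g, b)) (a, u, b') \<in> I"
        using I x y unfolding ideal_def by auto
      moreover have "rees mul q (rees mul q (a', mul g' h, b) (a, g, b)) (a, u, b') = y"
        using x y h by (simp add: rees_def)
      ultimately show "y \<in> I" by simp
    qed
  qed
  with sg have simple: "simple (A \<times> G \<times> B) (rees mul q)" by (simp add: simple_def)
  obtain a b where ab: "a \<in> A" "b \<in> B" using A B by blast
  obtain h where h: "h \<in> G" "mul (q b a) h = u" "mul h (q b a) = u" using iv[of "q b a"] ab by auto
  have "primitive_idempotent (A \<times> G \<times> B) (rees mul q) (a, h, b)"
    unfolding primitive_idempotent_def
  proof (intro conjI ballI impI)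
    show "(a, h, b) \<in> idempotents (A \<times> G \<times> B) (rees mul q)"
      using ab h by (simp add: idempotents_def idem_def rees_def)
  next
    fix f assume f: "f \<in> idempotents (A \<times> G \<times> B) (rees mul q)"
      "rees mul q (a, h, b) f = f \<and> rees mul q f (a, h, b) = f"
    then obtain g where g: "f = (a, g, b)" "g \<in> G"
      by (auto simp: idempotents_def rees_def)
    have "mul g (mul (q b a) g) = g"
      using f g ab by (simp add: idempotents_def idem_def rees_def)
    moreover obtain k where k: "k \<in> G" "mul k g = u" using iv[of g] g by auto
    ultimately have "mul (q b a) g = u" using g ab as[of k g "mul (q b a) g"] by simp
    then have "h = g" using g ab h as[of h "q b a" g] by simp
    then show "f = (a, h, b)" using g by simp
  qed
  with simple show ?thesis by (auto simp: completely_simple_def)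
qed

section \<open>Embeddings into lambda-semidirect products and renaming of the elements of K\<close>

definition lsd_embedding where
  "lsd_embedding S m T mT K mK eps \<psi> \<longleftrightarrow>
     completely_simple K mK \<and> left_action T mT K mK eps \<and> \<psi> ` S \<subseteq> lsd_carrier K T mT eps \<and>
     inj_on \<psi> S \<and> (\<forall>x\<in>S. \<forall>y\<in>S. \<psi> (m x y) = lsd_mult mK T mT eps (\<psi> x) (\<psi> y))"

lemma completely_simple_image:
  assumes K: "completely_simple K mK" and inj: "inj_on f K" and g: "\<And>x. x \<in> K \<Longrightarrow> g (f x) = x"
  shows "completely_simple (f ` K) (\<lambda>p q. f (mK (g p) (g q)))"
proof -
  let ?m = "\<lambda>p q. f (mK (g p) (g q))"
  have sg: "semigroup K mK" and id: "\<And>I. ideal I K mK \<Longrightarrow> I = K"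
    using K by (auto simp: completely_simple_def simple_def)
  have cl: "x \<in> K \<Longrightarrow> y \<in> K \<Longrightarrow> mK x y \<in> K" for x y using sg by (simp add: semigroup_def)
  have "semigroup (f ` K) ?m" using sg by (auto simp: semigroup_def g)
  moreover have "I = f ` K" if I: "ideal I (f ` K) ?m" for I
  proof -
    have "{x \<in> K. f x \<in> I} = K"
    proof (rule id, unfold ideal_def, intro conjI ballI)
      show "{x \<in> K. f x \<in> I} \<noteq> {}" using I by (auto simp: ideal_def)
      fix s x assume s: "s \<in> K" "x \<in> {x \<in> K. f x \<in> I}"
      then have "?m (f s) (f x) \<in> I" "?m (f x) (f s) \<in> I" using I unfolding ideal_def by blast+
      then show "mK s x \<in> {x \<in> K. f x \<in> I}" "mK x s \<in> {x \<in> K. f x \<in> I}"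
        using s cl g by auto
    qed auto
    then show ?thesis using I unfolding ideal_def by blast
  qed
  moreover obtain e where e: "primitive_idempotent K mK e" using K by (auto simp: completely_simple_def)
  have "primitive_idempotent (f ` K) ?m (f e)"
    using e inj cl by (auto simp: primitive_idempotent_def idempotents_def idem_def g inj_on_eq_iff)
  ultimately show ?thesis by (auto simp: completely_simple_def simple_def)
qed

text \<open>Transport of structure: the theorem prescribes the type of the elements of
  \<open>K\<close>, whereas the construction produces triples of functions.\<close>

lemma lsd_embedding_image:
  assumes emb: "lsd_embedding S m T mT K mK eps \<psi>" and inj: "inj_on f K"
    and sinv: "\<And>t. t \<in> T \<Longrightarrow> sinv T mT t \<in> T" and mT: "\<And>t u. t \<in> T \<Longrightarrow> u \<in> T \<Longrightarrow> mT t u \<in> T"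
  shows "\<exists>mK' eps'. lsd_embedding S m T mT (f ` K) mK' eps' (\<lambda>x. (f (fst (\<psi> x)), snd (\<psi> x)))"
proof -
  define g where "g = inv_into K f"
  have g: "g (f x) = x" if "x \<in> K" for x using inj that by (simp add: g_def)
  let ?m = "\<lambda>p q. f (mK (g p) (g q))" and ?eps = "\<lambda>t p. f (eps t (g p))"
  have K: "completely_simple K mK" and act: "left_action T mT K mK eps"
    and car: "\<And>x. x \<in> S \<Longrightarrow> \<psi> x \<in> lsd_carrier K T mT eps" and \<psi>: "inj_on \<psi> S"
    and hom: "\<And>x y. x \<in> S \<Longrightarrow> y \<in> S \<Longrightarrow> \<psi> (m x y) = lsd_mult mK T mT eps (\<psi> x) (\<psi> y)"
    using emb by (auto simp: lsd_embedding_def)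
  have cl: "x \<in> K \<Longrightarrow> y \<in> K \<Longrightarrow> mK x y \<in> K" for x y
    using K by (simp add: completely_simple_def simple_def semigroup_def)
  have eps: "eps t x \<in> K" if "t \<in> T" "x \<in> K" for t x
    using act that by (auto simp: left_action_def endomorphism_def)
  have car': "fst (\<psi> x) \<in> K" "snd (\<psi> x) \<in> T"
    "eps (mT (snd (\<psi> x)) (sinv T mT (snd (\<psi> x)))) (fst (\<psi> x)) = fst (\<psi> x)" if "x \<in> S" for x
    using car[OF that] by (auto simp: lsd_carrier_def)
  have "lsd_embedding S m T mT (f ` K) ?m ?eps (\<lambda>x. (f (fst (\<psi> x)), snd (\<psi> x)))"
    unfolding lsd_embedding_def
  proof (intro conjI)
    show "completely_simple (f ` K) ?m" using completely_simple_image K inj g by blast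
    show "left_action T mT (f ` K) ?m ?eps"
      using act eps g cl by (auto simp: left_action_def endomorphism_def)
    show "(\<lambda>x. (f (fst (\<psi> x)), snd (\<psi> x))) ` S \<subseteq> lsd_carrier (f ` K) T mT ?eps"
      using car' g by (auto simp: lsd_carrier_def)
    show "inj_on (\<lambda>x. (f (fst (\<psi> x)), snd (\<psi> x))) S"
      using \<psi> inj car' by (auto simp: inj_on_def prod_eq_iff)
    show "\<forall>x\<in>S. \<forall>y\<in>S. (f (fst (\<psi> (m x y))), snd (\<psi> (m x y))) =
        lsd_mult ?m T mT ?eps (f (fst (\<psi> x)), snd (\<psi> x)) (f (fst (\<psi> y)), snd (\<psi> y))"
      using hom car' eps g sinv mT by (auto simp: lsd_mult_def Let_def)
  qed
  then show ?thesis by blast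
qed

text \<open>The products \<open>x a y\<close> form an ideal, which by simplicity is
  everything.\<close>

lemma simple_factor:
  assumes P: "simple P m" and S: "a \<in> P" "b \<in> P"
  obtains x y where "x \<in> P" "y \<in> P" "b = m x (m a y)"
proof -
  have cl: "m x y \<in> P" if "x \<in> P" "y \<in> P" for x y
    using P that by (auto simp: simple_def semigroup_def)
  have as: "m (m x y) z = m x (m y z)" if "x \<in> P" "y \<in> P" "z \<in> P" for x y z
    using P that by (auto simp: simple_def semigroup_def)
  define J where "J = {m x (m a y) | x y. x \<in> P \<and> y \<in> P}"
  have "ideal J P m"
    unfolding ideal_def
  proof (intro conjI ballI)
    show "J \<subseteq> P" "J \<noteq> {}" using cl S by (auto simp: J_def)
    fix s z assume s: "s \<in> P" and "z \<in> J"
    then obtain x y where z: "z = m x (m a y)" "x \<in> P" "y \<in> P" by (auto simp: J_def)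
    have "m s z = m (m s x) (m a y)" "m z s = m x (m a (m y s))" using s z S cl as by auto
    then show "m s z \<in> J" "m z s \<in> J" using s z cl unfolding J_def by blast+
  qed
  then have "b \<in> J" using P S by (auto simp: simple_def)
  then show thesis using that by (auto simp: J_def)
qed

text \<open>The local submonoid at any idempotent is a group, and \<open>s'\<close> is the inverse
  of \<open>k s k\<close> in it. At the primitive idempotent \<open>e\<close> this follows from
  primitivity; it is carried over to \<open>k\<close> along a factorization \<open>k = x' y'\<close>
  with \<open>y' x' = e\<close>.\<close>

lemma completely_simple_local_group:
  assumes P: "completely_simple P m" and k: "k \<in> P" "m k k = k" and s: "s \<in> P"
  shows "\<exists>s'\<in>P. m k s' = s' \<and> m s' k = s' \<and> m k (m s s') = k \<and> m s' (m s k) = k"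
proof -
  have simple: "simple P m" using P by (simp add: completely_simple_def)
  have cl [simp]: "m x y \<in> P" if "x \<in> P" "y \<in> P" for x y
    using simple that by (auto simp: simple_def semigroup_def)
  have as [simp]: "m (m x y) z = m x (m y z)" if "x \<in> P" "y \<in> P" "z \<in> P" for x y z
    using simple that by (auto simp: simple_def semigroup_def)
  obtain e where e: "e \<in> P" "m e e = e" and
    prim: "\<And>f. f \<in> P \<Longrightarrow> m f f = f \<Longrightarrow> m e f = f \<Longrightarrow> m f e = f \<Longrightarrow> f = e"
    using P by (auto simp: completely_simple_def primitive_idempotent_def idempotents_def idem_def)
  have ee [simp]: "m e (m e x) = m e x" if "x \<in> P" for x using e that as by metis
  have inverse: "\<exists>c\<in>P. m e c = c \<and> m c e = c \<and> m b c = e \<and> m c b = e"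
    if b: "b \<in> P" "m e b = b" "m b e = b" for b
  proof -
    obtain x y where xy: "x \<in> P" "y \<in> P" "e = m x (m b y)" using simple_factor[OF simple b(1) e(1)] .
    define x' where "x' = m e (m x e)"
    define y' where "y' = m e (m y e)"
    have x': "x' \<in> P" "m e x' = x'" "m x' e = x'" and y': "y' \<in> P" "m e y' = y'" "m y' e = y'"
      using xy(1,2) e by (auto simp: x'_def y'_def)
    have "m x' (m b y') = m e (m x (m (m e b) (m e (m y e))))"
      using xy(1,2) e b(1) by (simp add: x'_def y'_def)
    also have "\<dots> = m e (m x (m (m b e) (m y e)))"
      using xy(1,2) e b by (metis as cl)
    also have "\<dots> = m e (m (m x (m b y)) e)" unfolding b using xy(1,2) e(1) b(1) by simp
    finally have 1: "m x' (m b y') = e" using xy(3) e by simp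
    have 2: "m x' (m b (m y' z)) = m e z" if "z \<in> P" for z
      using 1 that x' y' b as[of x' "m b y'" z] by simp
    have 3: "m e (m b z) = m b z" "m e (m x' z) = m x' z" "m e (m y' z) = m y' z" if "z \<in> P" for z
      using that x' y' b e as by metis+
    \<comment> \<open>Since \<open>x' b y' = e\<close>, both \<open>b y' x'\<close> and
      \<open>y' x' b\<close> are idempotents below \<open>e\<close>, so primitivity identifies them
      with \<open>e\<close>.\<close>
    have "m b (m y' x') = e"
      using x' y' b e 2 3 by (intro prim) simp_all
    moreover have "m y' (m x' b) = e"
      using x' y' b e 2 3 by (intro prim) simp_all
    ultimately show ?thesis
      using x' y' b e 3 by (intro bexI[of _ "m y' x'"]) simp_all
  qed
  obtain x y where xy: "x \<in> P" "y \<in> P" "k = m x (m e y)" using simple_factor[OF simple e(1) k(1)] .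
  define x' where "x' = m k (m x e)"
  define y' where "y' = m e (m y k)"
  have kk [simp]: "m k (m k x) = m k x" if "x \<in> P" for x using k that as by metis
  have x': "x' \<in> P" "m k x' = x'" "m x' e = x'" and y': "y' \<in> P" "m e y' = y'" "m y' k = y'"
    using xy(1,2) e k by (auto simp: x'_def y'_def)
  have "m x' y' = m k (m (m x (m e y)) k)" using xy(1,2) e k by (simp add: x'_def y'_def)
  then have x'y': "m x' y' = k" using xy(3) k by simp
  have x'y'z: "m x' (m y' z) = m k z" if "z \<in> P" for z using x'y' that x' y' as by metis
  have y'x': "m y' x' = e"
    using x' y' e x'y'z as[of e y' x'] by (intro prim) simp_all
  \<comment> \<open>The image \<open>y' s x'\<close> of \<open>s\<close> is inverted in the group at
    \<open>e\<close>; carrying \<open>c\<close> back gives \<open>s' = x' c y'\<close>.\<close>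
  obtain c where c: "c \<in> P" "m e c = c" "m c e = c" "m (m y' (m s x')) c = e" "m c (m y' (m s x')) = e"
    using inverse[of "m y' (m s x')"] x' y' s e as[of e y' "m s x'"] by auto
  have "m k (m s (m x' (m c y'))) = m x' (m (m (m y' (m s x')) c) y')"
    using x' y' c(1) s x'y'z by simp
  then have 1: "m k (m s (m x' (m c y'))) = k" using c y' x'y' by simp
  have "m (m x' (m c y')) (m s (m x' y')) = m (m x' (m c (m y' (m s x')))) y'"
    using x' y' c(1) s by simp
  then have 2: "m (m x' (m c y')) (m s k) = k" using c x' x'y' by simp
  show ?thesis
    using 1 2 x' y' c(1) k as[of k x' "m c y'"] by (intro bexI[of _ "m x' (m c y')"]) simp_all
qed

section \<open>Extensions with completely simple idempotent classes\<close>

text \<open>The projection \<open>\<pi>\<close> stands in for the congruence. All assumptions are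
  left-right symmetric, so the opposite multiplication is again an instance. In
  \<open>local_group\<close>, \<open>s'\<close> inverts \<open>k s k\<close> in the local group at
  \<open>k\<close> inside the class of \<open>k\<close>; \<open>local_commute\<close> is what local
  inverseness provides.\<close>

locale cs_extension = inverse_sgp T mT
  for T :: "'t set" and mT :: "'t \<Rightarrow> 't \<Rightarrow> 't" (infixl "\<odot>" 70) +
  fixes S :: "'a set" and m :: "'a \<Rightarrow> 'a \<Rightarrow> 'a" (infixl "\<cdot>" 70) and \<pi> :: "'a \<Rightarrow> 't"
  assumes closed [simp]: "x \<in> S \<Longrightarrow> y \<in> S \<Longrightarrow> x \<cdot> y \<in> S"
    and assoc [simp]: "x \<in> S \<Longrightarrow> y \<in> S \<Longrightarrow> z \<in> S \<Longrightarrow> x \<cdot> y \<cdot> z = x \<cdot> (y \<cdot> z)"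
    and \<pi>_closed [simp]: "x \<in> S \<Longrightarrow> \<pi> x \<in> T"
    and \<pi>_mult [simp]: "x \<in> S \<Longrightarrow> y \<in> S \<Longrightarrow> \<pi> (x \<cdot> y) = \<pi> x \<odot> \<pi> y"
    and \<pi>_surj: "t \<in> T \<Longrightarrow> \<exists>x\<in>S. \<pi> x = t"
    and inverse_exists: "a \<in> S \<Longrightarrow> \<exists>b\<in>S. a \<cdot> (b \<cdot> a) = a \<and> b \<cdot> (a \<cdot> b) = b"
    and idem_lift: "t \<in> T \<Longrightarrow> t \<odot> t = t \<Longrightarrow> \<exists>k\<in>S. k \<cdot> k = k \<and> \<pi> k = t"
    and local_group: "k \<in> S \<Longrightarrow> k \<cdot> k = k \<Longrightarrow> s \<in> S \<Longrightarrow> \<pi> s = \<pi> k \<Longrightarrow>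
      \<exists>s'\<in>S. \<pi> s' = \<pi> k \<and> k \<cdot> s' = s' \<and> s' \<cdot> k = s' \<and> k \<cdot> (s \<cdot> s') = k \<and> s' \<cdot> (s \<cdot> k) = k"
    and local_commute: "e \<in> S \<Longrightarrow> e \<cdot> e = e \<Longrightarrow> g \<in> S \<Longrightarrow> g \<cdot> g = g \<Longrightarrow> h \<in> S \<Longrightarrow> h \<cdot> h = h \<Longrightarrow>
      e \<cdot> g = g \<Longrightarrow> g \<cdot> e = g \<Longrightarrow> e \<cdot> h = h \<Longrightarrow> h \<cdot> e = h \<Longrightarrow> g \<cdot> h = h \<cdot> g"
begin

section \<open>Duality, idempotents below a given one, and translates\<close>

lemma assocL: "x \<in> S \<Longrightarrow> y \<in> S \<Longrightarrow> z \<in> S \<Longrightarrow> x \<cdot> (y \<cdot> z) = x \<cdot> y \<cdot> z"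
  by simp

lemma cs_extension_opp: "cs_extension T (\<lambda>x y. y \<odot> x) S (\<lambda>x y. y \<cdot> x) \<pi>"
proof (intro cs_extension.intro cs_extension_axioms.intro)
  show "inverse_sgp T (\<lambda>x y. y \<odot> x)"
    by (rule inverse_sgp_opp) (rule inverse_sgp_axioms)
next
  fix a assume a: "a \<in> S"
  then show "\<exists>b\<in>S. a \<cdot> b \<cdot> a = a \<and> b \<cdot> a \<cdot> b = b"
    using inverse_exists[of a] by (metis assoc)
next
  fix k s assume "k \<in> S" "k \<cdot> k = k" "s \<in> S" "\<pi> s = \<pi> k"
  then show "\<exists>s'\<in>S. \<pi> s' = \<pi> k \<and> s' \<cdot> k = s' \<and> k \<cdot> s' = s' \<and> s' \<cdot> s \<cdot> k = k \<and> k \<cdot> s \<cdot> s' = k"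
    using local_group[of k s] by (metis assoc)
next
  fix e g h assume "e \<in> S" "e \<cdot> e = e" "g \<in> S" "g \<cdot> g = g" "h \<in> S" "h \<cdot> h = h"
    "g \<cdot> e = g" "e \<cdot> g = g" "h \<cdot> e = h" "e \<cdot> h = h"
  then show "h \<cdot> g = g \<cdot> h" using local_commute[of e g h] by simp
qed (use \<pi>_surj idem_lift in auto)

lemma inverse_over:
  assumes "a \<in> S"
  obtains b where "b \<in> S" "a \<cdot> (b \<cdot> a) = a" "b \<cdot> (a \<cdot> b) = b" "\<pi> b = inv (\<pi> a)"
proof -
  obtain b where b: "b \<in> S" "a \<cdot> (b \<cdot> a) = a" "b \<cdot> (a \<cdot> b) = b"
    using inverse_exists[OF assms] by blast
  have "\<pi> a \<odot> (\<pi> b \<odot> \<pi> a) = \<pi> a" "\<pi> b \<odot> (\<pi> a \<odot> \<pi> b) = \<pi> b"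
    using b assms by (metis \<pi>_mult closed)+
  then have "inv (\<pi> a) = \<pi> b"
    using b assms by (intro inv_eqI) auto
  with b that show thesis by metis
qed

text \<open>The element \<open>k \<cdot> e \<cdot> k\<close> lies over \<open>\<pi> k\<close>, so it
  has an inverse \<open>s\<close> in the local group at \<open>k\<close>. Then
  \<open>k \<cdot> e \<cdot> s = k\<close>, and \<open>h = e \<cdot> s \<cdot> e\<close> is the
  required idempotent.\<close>

lemma idem_below:
  assumes e: "e \<in> S" "e \<cdot> e = e" and k: "k \<in> S" "k \<cdot> k = k" and le: "\<pi> k \<odot> \<pi> e = \<pi> k"
  obtains h where "h \<in> S" "h \<cdot> h = h" "\<pi> h = \<pi> k" "e \<cdot> h = h" "h \<cdot> e = h"
    "k \<cdot> e = k \<cdot> h"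
proof -
  have pk: "\<pi> k \<odot> \<pi> k = \<pi> k" and pe: "\<pi> e \<odot> \<pi> e = \<pi> e" using e k by (metis \<pi>_mult)+
  have le': "\<pi> e \<odot> \<pi> k = \<pi> k" using idem_commute[OF _ pe _ pk] e k le by simp
  have "\<pi> (k \<cdot> e \<cdot> k) = \<pi> k" using e k pk le' by simp
  then obtain s where s: "s \<in> S" "\<pi> s = \<pi> k" "k \<cdot> s = s" "s \<cdot> k = s"
    "k \<cdot> ((k \<cdot> e \<cdot> k) \<cdot> s) = k" "s \<cdot> ((k \<cdot> e \<cdot> k) \<cdot> k) = k"
    using local_group[OF k, of "k \<cdot> e \<cdot> k"] e k by auto
  have 1: "k \<cdot> (e \<cdot> s) = k" "s \<cdot> (e \<cdot> k) = k"
    using s e k by (metis assoc closed)+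
  have ee: "e \<cdot> (e \<cdot> y) = e \<cdot> y" if "y \<in> S" for y using e that by (metis assoc)
  show thesis
  proof
    show "e \<cdot> s \<cdot> e \<in> S" using e s by simp
    have "s \<cdot> (e \<cdot> (s \<cdot> e)) = s \<cdot> e"
      using s 1 e k by (metis assoc closed)
    then show "e \<cdot> s \<cdot> e \<cdot> (e \<cdot> s \<cdot> e) = e \<cdot> s \<cdot> e"
      using s e ee by simp
    show "\<pi> (e \<cdot> s \<cdot> e) = \<pi> k" using e s k le le' by simp
    show "e \<cdot> (e \<cdot> s \<cdot> e) = e \<cdot> s \<cdot> e" "e \<cdot> s \<cdot> e \<cdot> e = e \<cdot> s \<cdot> e"
      using e s ee by simp_all
    show "k \<cdot> e = k \<cdot> (e \<cdot> s \<cdot> e)"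
      using e s k 1 by (metis assoc closed)
  qed
qed

text \<open>Two idempotents below \<open>e\<close> commute, and commuting idempotents in one
  completely simple class coincide: \<open>g \<cdot> h \<cdot> s = g\<close> yields
  \<open>h \<cdot> g = g\<close>, and symmetrically \<open>g \<cdot> h = h\<close>.\<close>

lemma idem_below_unique:
  assumes e: "e \<in> S" "e \<cdot> e = e"
    and g: "g \<in> S" "g \<cdot> g = g" "e \<cdot> g = g" "g \<cdot> e = g"
    and h: "h \<in> S" "h \<cdot> h = h" "e \<cdot> h = h" "h \<cdot> e = h"
    and eq: "\<pi> g = \<pi> h"
  shows "g = h"
proof -
  have c: "g \<cdot> h = h \<cdot> g" using local_commute e g h by blast
  obtain s where s: "s \<in> S" "g \<cdot> (h \<cdot> s) = g" using local_group[of g h] g h eq by metis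
  obtain t where t: "t \<in> S" "h \<cdot> (g \<cdot> t) = h" using local_group[of h g] g h eq by metis
  have "h \<cdot> g = g" using s c g h by (metis assoc closed)
  moreover have "g \<cdot> h = h" using t c g h by (metis assoc closed)
  ultimately show ?thesis using c by simp
qed

text \<open>The idempotents of the class of \<open>inv y \<odot> y\<close> obtained below \<open>b b'\<close> from \<open>c\<close> and from \<open>c'\<close>
  coincide by \<open>idem_below_unique\<close>; this is the only use of local inverseness.\<close>

lemma left_translates:
  assumes S: "c \<in> S" "c' \<in> S" "b \<in> S" "k \<in> S" and y: "\<pi> c = y" "\<pi> c' = y"
    and k: "\<pi> k = y \<odot> inv y" "k \<cdot> c = c" "k \<cdot> k = k" "k \<cdot> c' = c'"
    and le: "y \<odot> (\<pi> b \<odot> inv (\<pi> b)) = y"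
  shows "\<exists>n\<in>S. \<pi> n = \<pi> k \<and> k \<cdot> n = n \<and> n \<cdot> k = n \<and> c \<cdot> b = n \<cdot> (c' \<cdot> b)"
proof -
  have yT: "y \<in> T" using S y by auto
  obtain b' where b': "b' \<in> S" "b \<cdot> (b' \<cdot> b) = b" "b' \<cdot> (b \<cdot> b') = b'" "\<pi> b' = inv (\<pi> b)"
    using inverse_over S by metis
  define e where "e = b \<cdot> b'"
  have e: "e \<in> S" "e \<cdot> e = e" "\<pi> e = \<pi> b \<odot> inv (\<pi> b)" and eb: "e \<cdot> b = b"
    using S b' by (simp_all add: e_def)
  \<comment> \<open>For each \<open>x\<close> over \<open>y\<close>, multiplying by \<open>e\<close>
    on the right amounts to multiplying by an idempotent \<open>h\<close> below \<open>e\<close>,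
    and \<open>d\<close> undoes \<open>x\<close> on the left up to \<open>h\<close>. Here
    \<open>d = s \<cdot> x'\<close>, where \<open>s\<close> inverts
    \<open>h \<cdot> x' \<cdot> x \<cdot> h\<close> in the local group at \<open>h\<close>.\<close>
  have key: "\<exists>h d. h \<in> S \<and> h \<cdot> h = h \<and> \<pi> h = inv y \<odot> y \<and> e \<cdot> h = h \<and> h \<cdot> e = h \<and> x \<cdot> e = x \<cdot> h \<and>
      d \<in> S \<and> \<pi> d = inv y \<and> d \<cdot> (x \<cdot> h) = h \<and> h \<cdot> d = d"
    if x: "x \<in> S" "\<pi> x = y" for x
  proof -
    obtain x' where x': "x' \<in> S" "x \<cdot> (x' \<cdot> x) = x" "x' \<cdot> (x \<cdot> x') = x'" "\<pi> x' = inv y"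
      using inverse_over x by metis
    have i: "(x' \<cdot> x) \<cdot> (x' \<cdot> x) = x' \<cdot> x" using x x' by simp
    have "\<pi> (x' \<cdot> x) \<odot> \<pi> e = \<pi> (x' \<cdot> x)" using e x x' yT S le by simp
    from idem_below[OF e(1,2) _ i this] x x'
    obtain h where h: "h \<in> S" "h \<cdot> h = h" "\<pi> h = \<pi> (x' \<cdot> x)" "e \<cdot> h = h" "h \<cdot> e = h"
      "(x' \<cdot> x) \<cdot> e = (x' \<cdot> x) \<cdot> h" by auto
    obtain s where s: "s \<in> S" "\<pi> s = \<pi> h" "h \<cdot> s = s" "s \<cdot> h = s" "s \<cdot> ((x' \<cdot> x) \<cdot> h) = h"
      using local_group[of h "x' \<cdot> x"] h x x' by auto
    have "x \<cdot> e = x \<cdot> h" using h(6) x x' e h by (metis assoc closed)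
    moreover have "(s \<cdot> x') \<cdot> (x \<cdot> h) = h" using s(5) s h x x' by simp
    moreover have "h \<cdot> (s \<cdot> x') = s \<cdot> x'" using s h x' by (metis assoc)
    moreover have "\<pi> (s \<cdot> x') = inv y" using s h x x' yT by simp
    moreover have "\<pi> h = inv y \<odot> y" using h x x' by simp
    ultimately show ?thesis using h s x' closed by blast
  qed
  obtain h where h: "h \<in> S" "h \<cdot> h = h" "\<pi> h = inv y \<odot> y" "e \<cdot> h = h" "h \<cdot> e = h" "c \<cdot> e = c \<cdot> h"
    using key[of c] S y by auto
  obtain h' d where h': "h' \<in> S" "h' \<cdot> h' = h'" "\<pi> h' = inv y \<odot> y" "e \<cdot> h' = h'" "h' \<cdot> e = h'"
    "c' \<cdot> e = c' \<cdot> h'" and d: "d \<in> S" "\<pi> d = inv y" "d \<cdot> (c' \<cdot> h') = h'" "h' \<cdot> d = d"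
    using key[of c'] S y by auto
  have hh: "h' = h" using idem_below_unique[of e h' h] h h' e by simp
  \<comment> \<open>Inserting \<open>h = d \<cdot> c' \<cdot> h\<close> exchanges \<open>c\<close>
    for \<open>c'\<close>. The multiplier is \<open>c \<cdot> d \<cdot> k\<close>, the final
    \<open>k\<close> being added so that \<open>k\<close> is a unit for it on both sides.\<close>
  have "c \<cdot> b = c \<cdot> h \<cdot> b" using h eb S e by (metis assoc)
  also have "\<dots> = c \<cdot> (d \<cdot> (c' \<cdot> h)) \<cdot> b" using d hh by simp
  also have "\<dots> = (c \<cdot> d) \<cdot> (c' \<cdot> h \<cdot> b)" using d h S by simp
  also have "c' \<cdot> h \<cdot> b = c' \<cdot> b" using h' hh eb S e by (metis assoc)
  also have "(c \<cdot> d) \<cdot> (c' \<cdot> b) = (c \<cdot> d \<cdot> k) \<cdot> (c' \<cdot> b)"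
    using S d k by (metis assoc closed)
  finally have "c \<cdot> b = (c \<cdot> d \<cdot> k) \<cdot> (c' \<cdot> b)" .
  moreover have "\<pi> (c \<cdot> d \<cdot> k) = \<pi> k" using S d k y yT by simp
  moreover have "k \<cdot> (c \<cdot> d \<cdot> k) = c \<cdot> d \<cdot> k" using S d k by (metis assoc closed)
  moreover have "c \<cdot> d \<cdot> k \<cdot> k = c \<cdot> d \<cdot> k" using S d k by simp
  ultimately show ?thesis using S d by (metis closed)
qed

text \<open>The dual of \<open>left_translates\<close>, read in the opposite extension.\<close>

lemma right_translates:
  assumes S: "c \<in> S" "c' \<in> S" "b \<in> S" "k \<in> S" and y: "\<pi> c = y" "\<pi> c' = y"
    and k: "\<pi> k = inv y \<odot> y" "c \<cdot> k = c" "k \<cdot> k = k" "c' \<cdot> k = c'"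
    and le: "(inv (\<pi> b) \<odot> \<pi> b) \<odot> y = y"
  shows "\<exists>n\<in>S. \<pi> n = \<pi> k \<and> k \<cdot> n = n \<and> n \<cdot> k = n \<and> b \<cdot> c = (b \<cdot> c') \<cdot> n"
proof -
  have inv: "inverse_sgp.inv T (\<lambda>x y. y \<odot> x) x = inv x" if "x \<in> T" for x
    by (rule inverse_sgp_opp(2)[OF inverse_sgp_axioms that])
  have T: "y \<in> T" "\<pi> b \<in> T" using S y by auto
  show ?thesis
    using cs_extension.left_translates[OF cs_extension_opp S y] k le unfolding inv[OF T(1)] inv[OF T(2)]
    by blast
qed

end

section \<open>Rees coordinates of arrows\<close>

context cs_extension begin

section \<open>Transversals, the groups N e, and orbit representatives\<close>

definition rep :: "'t \<Rightarrow> 'a" where "rep t = (SOME x. x \<in> S \<and> \<pi> x = t)"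

lemma rep: "t \<in> T \<Longrightarrow> rep t \<in> S" "t \<in> T \<Longrightarrow> \<pi> (rep t) = t"
  using someI_ex[of "\<lambda>x. x \<in> S \<and> \<pi> x = t"] \<pi>_surj[of t] by (auto simp: rep_def)

lemma rep_eq_iff: "x \<in> T \<Longrightarrow> y \<in> T \<Longrightarrow> rep x = rep y \<longleftrightarrow> x = y"
  by (metis rep(2))

definition E :: "'t set" where "E = {e \<in> T. e \<odot> e = e}"

definition \<epsilon> :: "'t \<Rightarrow> 'a" where "\<epsilon> e = (SOME k. k \<in> S \<and> k \<cdot> k = k \<and> \<pi> k = e)"

definition N :: "'t \<Rightarrow> 'a set" where
  "N e = {n \<in> S. \<pi> n = e \<and> \<epsilon> e \<cdot> n = n \<and> n \<cdot> \<epsilon> e = n}"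

text \<open>Fixed links between the objects of an \<R>-class. \<open>r z\<close> and
  \<open>r' z\<close> need not be mutually inverse; what counts is that
  \<open>\<epsilon> (z \<odot> inv z)\<close> is a left unit of the first and a right unit of the
  second, so that products closing up to an idempotent fall into a group \<open>N e\<close>.\<close>

definition r :: "'t \<Rightarrow> 'a" where
  "r z = \<epsilon> (z \<odot> inv z) \<cdot> rep z"

definition r' :: "'t \<Rightarrow> 'a" where
  "r' z = rep (inv z) \<cdot> \<epsilon> (z \<odot> inv z)"

text \<open>The choice depends on \<open>v\<close> only through \<open>\<pi> v\<close> and its
  orbit, so elements of one orbit get literally the same representative.\<close>

definition left_rep :: "'a \<Rightarrow> 'a" where
  "left_rep v = (SOME v'. \<exists>n \<in> N (\<pi> v \<odot> inv (\<pi> v)). v' = n \<cdot> v)"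

definition right_rep :: "'a \<Rightarrow> 'a" where
  "right_rep w = (SOME w'. \<exists>n \<in> N (inv (\<pi> w) \<odot> \<pi> w). w' = w \<cdot> n)"

lemma range_E [simp]: "z \<in> T \<Longrightarrow> z \<odot> inv z \<in> E"
  by (simp add: E_def)

lemma \<epsilon>:
  assumes "e \<in> E"
  shows "\<epsilon> e \<in> S" "\<epsilon> e \<cdot> \<epsilon> e = \<epsilon> e" "\<pi> (\<epsilon> e) = e"
proof -
  have "\<exists>k. k \<in> S \<and> k \<cdot> k = k \<and> \<pi> k = e" using assms idem_lift by (auto simp: E_def)
  from someI_ex[OF this] show "\<epsilon> e \<in> S" "\<epsilon> e \<cdot> \<epsilon> e = \<epsilon> e" "\<pi> (\<epsilon> e) = e"
    unfolding \<epsilon>_def by blast+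
qed

lemma N_subset: "n \<in> N e \<Longrightarrow> n \<in> S" "n \<in> N e \<Longrightarrow> \<pi> n = e"
  and N_unit: "n \<in> N e \<Longrightarrow> \<epsilon> e \<cdot> n = n" "n \<in> N e \<Longrightarrow> n \<cdot> \<epsilon> e = n"
  by (auto simp: N_def)

lemma \<epsilon>_in_N: "e \<in> E \<Longrightarrow> \<epsilon> e \<in> N e"
  using \<epsilon> by (auto simp: N_def)

lemma N_closed: "e \<in> E \<Longrightarrow> n \<in> N e \<Longrightarrow> n' \<in> N e \<Longrightarrow> n \<cdot> n' \<in> N e"
  using \<epsilon>[of e] assocL[of "\<epsilon> e" n n'] by (auto simp: N_def E_def)

lemma N_inverse:
  assumes "e \<in> E" "n \<in> N e"
  obtains n' where "n' \<in> N e" "n \<cdot> n' = \<epsilon> e" "n' \<cdot> n = \<epsilon> e"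
proof -
  note \<epsilon> = \<epsilon>[OF assms(1)]
  obtain s where s: "s \<in> S" "\<pi> s = e" "\<epsilon> e \<cdot> s = s" "s \<cdot> \<epsilon> e = s"
    "\<epsilon> e \<cdot> (n \<cdot> s) = \<epsilon> e" "s \<cdot> (n \<cdot> \<epsilon> e) = \<epsilon> e"
    using local_group[OF \<epsilon>(1,2), of n] assms \<epsilon> by (auto simp: N_def)
  have "n \<cdot> s = \<epsilon> e" "s \<cdot> n = \<epsilon> e"
    using s assms \<epsilon> by (auto simp: N_def dest: assocL)
  with s that show thesis by (auto simp: N_def)
qed

lemma N_cancel_left:
  assumes e: "e \<in> E" and N: "p \<in> N e" "n \<in> N e" "n' \<in> N e" and eq: "p \<cdot> n = p \<cdot> n'"
  shows "n = n'"
proof -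
  obtain q where q: "q \<in> N e" "q \<cdot> p = \<epsilon> e" using N_inverse e N(1) by metis
  have "q \<cdot> p \<cdot> n = q \<cdot> p \<cdot> n'" using q N eq by (metis N_subset(1) assoc)
  then show ?thesis using q N by (simp add: N_unit)
qed

lemma N_cancel_right:
  assumes e: "e \<in> E" and N: "p \<in> N e" "n \<in> N e" "n' \<in> N e" and eq: "n \<cdot> p = n' \<cdot> p"
  shows "n = n'"
proof -
  obtain q where q: "q \<in> N e" "p \<cdot> q = \<epsilon> e" using N_inverse e N(1) by metis
  have "n \<cdot> (p \<cdot> q) = n' \<cdot> (p \<cdot> q)" using q N eq by (metis N_subset(1) assoc)
  then show ?thesis using q N by (simp add: N_unit)
qed

lemma r:
  assumes "z \<in> T"
  shows "r z \<in> S" "\<pi> (r z) = z" "\<epsilon> (z \<odot> inv z) \<cdot> r z = r z"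
  using \<epsilon>[of "z \<odot> inv z"] rep[of z] assms
    assocL[of "\<epsilon> (z \<odot> inv z)" "\<epsilon> (z \<odot> inv z)" "rep z"]
  by (auto simp: r_def)

lemma r':
  assumes "z \<in> T"
  shows "r' z \<in> S" "\<pi> (r' z) = inv z" "r' z \<cdot> \<epsilon> (z \<odot> inv z) = r' z"
  using \<epsilon>[of "z \<odot> inv z"] rep[of "inv z"] assms by (auto simp: r'_def)

lemma left_rep:
  assumes "v \<in> S" "\<pi> v \<odot> inv (\<pi> v) = e"
  obtains n where "n \<in> N e" "left_rep v = n \<cdot> v"
proof -
  have "e \<in> E" using assms by auto
  then have "\<exists>v'. \<exists>n \<in> N e. v' = n \<cdot> v"
    using \<epsilon>_in_N[of e] by auto
  from someI_ex[OF this] show thesis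
    using that assms unfolding left_rep_def by blast
qed

lemma right_rep:
  assumes "w \<in> S" "inv (\<pi> w) \<odot> \<pi> w = e"
  obtains n where "n \<in> N e" "right_rep w = w \<cdot> n"
proof -
  have "e \<in> E" using assms by (auto simp: E_def)
  then have "\<exists>w'. \<exists>n \<in> N e. w' = w \<cdot> n"
    using \<epsilon>_in_N[of e] by auto
  from someI_ex[OF this] show thesis
    using that assms unfolding right_rep_def by blast
qed

text \<open>As \<open>n\<close> is invertible in \<open>N e\<close> and \<open>\<epsilon> e\<close>
  fixes \<open>v\<close>, the orbits of \<open>v'\<close> and \<open>v\<close> are the same
  set.\<close>

lemma left_rep_cong:
  assumes v: "v \<in> S" and e: "\<pi> v \<odot> inv (\<pi> v) = e" "\<epsilon> e \<cdot> v = v" and n: "n \<in> N e" and v': "v' = n \<cdot> v"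
  shows "left_rep v' = left_rep v"
proof -
  have eE: "e \<in> E" using assms by auto
  have \<pi>: "\<pi> v' = \<pi> v" using v v' n e(1) by (auto simp: N_def)
  obtain q where q: "q \<in> N e" "q \<cdot> n = \<epsilon> e" using N_inverse eE n by metis
  have "(\<exists>k \<in> N e. x = k \<cdot> v') \<longleftrightarrow> (\<exists>k \<in> N e. x = k \<cdot> v)" for x
  proof
    assume "\<exists>k \<in> N e. x = k \<cdot> v'"
    then obtain k where "k \<in> N e" "x = k \<cdot> v'" by blast
    then show "\<exists>k \<in> N e. x = k \<cdot> v"
      using v n v' N_closed[OF eE] by (intro bexI[of _ "k \<cdot> n"]) (auto simp: N_subset)
  next
    assume "\<exists>k \<in> N e. x = k \<cdot> v"
    then obtain k where k: "k \<in> N e" "x = k \<cdot> v" by blast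
    have "k \<cdot> q \<cdot> v' = k \<cdot> ((q \<cdot> n) \<cdot> v)"
      using k q v v' n by (metis N_subset(1) assoc closed)
    then show "\<exists>k \<in> N e. x = k \<cdot> v'"
      using k q e N_closed[OF eE] by (intro bexI[of _ "k \<cdot> q"]) auto
  qed
  then show ?thesis by (simp add: left_rep_def \<pi> e)
qed

lemma right_rep_cong:
  assumes w: "w \<in> S" and e: "inv (\<pi> w) \<odot> \<pi> w = e" "w \<cdot> \<epsilon> e = w" and n: "n \<in> N e" and w': "w' = w \<cdot> n"
  shows "right_rep w' = right_rep w"
proof -
  have eE: "e \<in> E" using assms by (auto simp: E_def)
  have \<pi>: "\<pi> w' = \<pi> w" using w w' n e(1) by (auto simp: N_def)
  obtain q where q: "q \<in> N e" "n \<cdot> q = \<epsilon> e" using N_inverse eE n by metis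
  have "(\<exists>k \<in> N e. x = w' \<cdot> k) \<longleftrightarrow> (\<exists>k \<in> N e. x = w \<cdot> k)" for x
  proof
    assume "\<exists>k \<in> N e. x = w' \<cdot> k"
    then obtain k where "k \<in> N e" "x = w' \<cdot> k" by blast
    then show "\<exists>k \<in> N e. x = w \<cdot> k"
      using w n w' N_closed[OF eE] by (intro bexI[of _ "n \<cdot> k"]) (auto simp: N_subset)
  next
    assume "\<exists>k \<in> N e. x = w \<cdot> k"
    then obtain k where k: "k \<in> N e" "x = w \<cdot> k" by blast
    have "w' \<cdot> (q \<cdot> k) = (w \<cdot> (n \<cdot> q)) \<cdot> k"
      using k q w w' n by (metis N_subset(1) assoc closed)
    then show "\<exists>k \<in> N e. x = w' \<cdot> k"
      using k q e N_closed[OF eE] by (intro bexI[of _ "q \<cdot> k"]) auto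
  qed
  then show ?thesis by (simp add: right_rep_def \<pi> e)
qed

section \<open>Arrows, their composition and their coordinates\<close>

definition arrow :: "'t \<Rightarrow> 'a \<Rightarrow> bool" where
  "arrow z a \<longleftrightarrow> z \<in> T \<and> a \<in> S \<and> z \<odot> (\<pi> a \<odot> inv (\<pi> a)) = z"

text \<open>An element \<open>a\<close> over \<open>t\<close> is regarded as an arrow from \<open>z\<close> to \<open>z t\<close> whenever
  \<open>z t t\<inverse> = z\<close>. Its Rees coordinates \<open>(W, C, V)\<close> factor the restriction of \<open>a\<close> to \<open>z\<close> as
  \<open>W C V\<close> with \<open>C\<close> in the group \<open>N (z z\<inverse>)\<close>.\<close>

definition W :: "'t \<Rightarrow> 'a \<Rightarrow> 'a" where "W z a = right_rep (a \<cdot> r' (z \<odot> \<pi> a))"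

definition V :: "'t \<Rightarrow> 'a \<Rightarrow> 'a" where "V z a = left_rep (r z \<cdot> a)"

definition C :: "'t \<Rightarrow> 'a \<Rightarrow> 'a" where
  "C z a = (THE n. n \<in> N (z \<odot> inv z) \<and>
     (r z \<cdot> W z a) \<cdot> (n \<cdot> (V z a \<cdot> r' (z \<odot> \<pi> a))) = r z \<cdot> (a \<cdot> r' (z \<odot> \<pi> a)))"

text \<open>Source and target of an arrow are \<R>-related, so the same group \<open>N e\<close>
  serves for both.\<close>

lemma arrow_target:
  assumes "arrow z a"
  shows "(z \<odot> \<pi> a) \<odot> inv (z \<odot> \<pi> a) = z \<odot> inv z"
proof -
  have S: "z \<in> T" "a \<in> S" using assms by (auto simp: arrow_def)
  have "(z \<odot> \<pi> a) \<odot> inv (z \<odot> \<pi> a) = (z \<odot> (\<pi> a \<odot> inv (\<pi> a))) \<odot> inv z"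
    using S by (simp add: inv_mult_distrib)
  then show ?thesis using assms by (simp only: arrow_def)
qed

text \<open>Inverting \<open>z = z \<odot> (\<pi> a \<odot> inv (\<pi> a))\<close> gives this; it
  places \<open>a \<cdot> r' (z \<odot> \<pi> a)\<close> over \<open>inv z\<close>.\<close>

lemma arrow_back:
  assumes "arrow z a"
  shows "\<pi> a \<odot> inv (z \<odot> \<pi> a) = inv z"
proof -
  have S: "z \<in> T" "a \<in> S" using assms by (auto simp: arrow_def)
  have "inv (z \<odot> (\<pi> a \<odot> inv (\<pi> a))) = \<pi> a \<odot> inv (z \<odot> \<pi> a)"
    using S by (simp add: inv_mult_distrib)
  then show ?thesis using assms by (simp only: arrow_def)
qed

text \<open>With \<open>t = \<pi> a\<close> and \<open>u = \<pi> b\<close>, the idempotent of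
  \<open>t \<odot> u\<close> lies below \<open>t \<odot> inv t\<close>, which gives the first arrow.
  The second follows since \<open>inv t \<odot> t\<close> and \<open>u \<odot> inv u\<close>
  commute.\<close>

lemma arrow_mult:
  assumes z: "z \<in> T" and S: "a \<in> S" "b \<in> S" and ab: "arrow z (a \<cdot> b)"
  shows "arrow z a" "arrow (z \<odot> \<pi> a) b"
proof -
  define t u where "t = \<pi> a" and "u = \<pi> b"
  have T: "t \<in> T" "u \<in> T" using S by (auto simp: t_def u_def)
  have eq: "z \<odot> (t \<odot> (u \<odot> (inv u \<odot> inv t))) = z"
    using ab S z T by (simp add: arrow_def t_def[symmetric] u_def[symmetric] inv_mult_distrib)
  have "z \<odot> (t \<odot> inv t) = z \<odot> (t \<odot> (u \<odot> (inv u \<odot> inv t))) \<odot> (t \<odot> inv t)" by (simp only: eq)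
  also have "\<dots> = z \<odot> (t \<odot> (u \<odot> (inv u \<odot> inv t)))" using T z by simp
  finally show "arrow z a" using eq z S by (simp add: arrow_def t_def)
  have c: "(inv t \<odot> t) \<odot> (u \<odot> inv u) = (u \<odot> inv u) \<odot> (inv t \<odot> t)"
    using T by (intro idem_commute) auto
  have "z \<odot> t = z \<odot> (t \<odot> (u \<odot> (inv u \<odot> inv t))) \<odot> t" by (simp only: eq)
  also have "\<dots> = z \<odot> (t \<odot> ((u \<odot> inv u) \<odot> (inv t \<odot> t)))" using T z by simp
  also have "\<dots> = z \<odot> ((t \<odot> (inv t \<odot> t)) \<odot> (u \<odot> inv u))" unfolding c[symmetric] using T z by (simp del: inv_mult1)
  also have "\<dots> = (z \<odot> t) \<odot> (u \<odot> inv u)" using T z by simp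
  finally show "arrow (z \<odot> \<pi> a) b" using z S by (simp add: arrow_def t_def u_def)
qed

text \<open>Multiplying by \<open>r z\<close> and \<open>r' y\<close> moves the factorization into
  the group \<open>N e\<close>, where \<open>p = r z \<cdot> W z a\<close> and
  \<open>q = V z a \<cdot> r' y\<close> are invertible; hence the middle factor exists and is
  unique. The one-sided identities hold because \<open>W z a\<close> and \<open>V z a\<close> come
  from the orbits of \<open>a \<cdot> r' y\<close> and \<open>r z \<cdot> a\<close>.\<close>

lemma coordinates:
  assumes a: "arrow z a"
  defines "y \<equiv> z \<odot> \<pi> a" and "e \<equiv> z \<odot> inv z"
  shows W_S: "W z a \<in> S" "\<pi> (W z a) = inv z" "W z a \<cdot> \<epsilon> e = W z a"
    and V_S: "V z a \<in> S" "\<pi> (V z a) = y" "\<epsilon> e \<cdot> V z a = V z a"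
    and C_N: "C z a \<in> N e"
    and C_left: "r z \<cdot> a = (r z \<cdot> W z a) \<cdot> (C z a \<cdot> V z a)"
    and C_right: "a \<cdot> r' y = W z a \<cdot> (C z a \<cdot> (V z a \<cdot> r' y))"
    and C_unique: "n \<in> N e \<Longrightarrow>
      (r z \<cdot> W z a) \<cdot> (n \<cdot> (V z a \<cdot> r' y)) = r z \<cdot> (a \<cdot> r' y) \<Longrightarrow> C z a = n"
proof -
  have zT: "z \<in> T" and aS: "a \<in> S" and yT: "y \<in> T" using a by (auto simp: arrow_def y_def)
  have eE: "e \<in> E" using zT by (simp add: e_def)
  have ye: "y \<odot> inv y = e" using arrow_target[OF a] by (simp add: y_def e_def)
  have yb: "\<pi> a \<odot> inv y = inv z" using arrow_back[OF a] by (simp add: y_def)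
  note \<epsilon> = \<epsilon>[OF eE]
  note rz = r[OF zT, folded e_def] and ry = r'[OF yT, unfolded ye]
  have ez: "e \<odot> z = z" and ey: "e \<odot> y = y" and ze: "inv z \<odot> e = inv z" and ezz: "z \<odot> inv z = e"
    using zT yT ye by (auto simp: e_def) (metis T_assoc inv_closed inv_mult1)
  obtain l where l: "l \<in> N e" "W z a = a \<cdot> r' y \<cdot> l"
    using right_rep[of "a \<cdot> r' y" e] aS ry yb zT yT by (auto simp: W_def y_def[symmetric] e_def)
  have "\<pi> (r z \<cdot> a) = y" using rz aS by (simp add: y_def)
  then obtain k where k: "k \<in> N e" "V z a = k \<cdot> (r z \<cdot> a)"
    using left_rep[of "r z \<cdot> a" e] aS rz ye by (auto simp: V_def)
  note lN = N_subset[OF l(1)] N_unit[OF l(1)] and kN = N_subset[OF k(1)] N_unit[OF k(1)]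
  show W: "W z a \<in> S" "\<pi> (W z a) = inv z" "W z a \<cdot> \<epsilon> e = W z a"
    using l lN aS ry yb \<epsilon> ze zT yT T_assoc[of "\<pi> a" "inv y" e] by (auto simp del: T_assoc)
  show V: "V z a \<in> S" "\<pi> (V z a) = y" "\<epsilon> e \<cdot> V z a = V z a"
    using k kN aS rz \<epsilon> ey zT yT assocL[of "\<epsilon> e" k "r z \<cdot> a"] by (auto simp: y_def[symmetric])
  define p where "p = r z \<cdot> W z a"
  define q where "q = V z a \<cdot> r' y"
  have p: "p \<in> N e" using W rz \<epsilon> ezz assocL[of "\<epsilon> e" "r z" "W z a"] by (auto simp: p_def N_def)
  have q: "q \<in> N e" using V ry \<epsilon> ye assocL[of "\<epsilon> e" "V z a" "r' y"] by (auto simp: q_def N_def)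
  note pN = N_subset[OF p] and qN = N_subset[OF q]
  \<comment> \<open>These inverses undo \<open>p\<close> and the orbit coefficients \<open>k\<close>
    and \<open>l\<close>: \<open>p' \<cdot> k'\<close> turns out to be \<open>C z a\<close>, and
    \<open>W z a \<cdot> l'\<close> recovers \<open>a \<cdot> r' y\<close>.\<close>
  obtain p' where p': "p' \<in> N e" "p \<cdot> p' = \<epsilon> e" using N_inverse eE p by metis
  obtain k' where k': "k' \<in> N e" "k' \<cdot> k = \<epsilon> e" using N_inverse eE k by metis
  obtain l' where l': "l' \<in> N e" "l \<cdot> l' = \<epsilon> e" using N_inverse eE l by metis
  have inN: "p' \<cdot> k' \<in> N e" using N_closed eE p' k' by blast
  have "k' \<cdot> V z a = k' \<cdot> k \<cdot> (r z \<cdot> a)" using k k' rz aS by (metis N_subset(1) assoc closed)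
  also have "\<dots> = r z \<cdot> a" using k' rz aS \<epsilon> assocL[of "\<epsilon> e" "r z" a] by simp
  finally have ra: "k' \<cdot> V z a = r z \<cdot> a" .
  have "W z a \<cdot> l' = a \<cdot> (r' y \<cdot> (l \<cdot> l'))" using l l' lN ry aS by (simp add: N_subset)
  then have ar: "W z a \<cdot> l' = a \<cdot> r' y" using l' ry by simp
  have "p \<cdot> ((p' \<cdot> k') \<cdot> V z a) = (p \<cdot> p') \<cdot> (k' \<cdot> V z a)"
    using pN p' k' V(1) by (metis N_subset(1) assoc closed)
  also have "\<dots> = r z \<cdot> a" using ra p' aS rz \<epsilon> assocL[of "\<epsilon> e" "r z" a] by simp
  finally have left: "r z \<cdot> a = p \<cdot> ((p' \<cdot> k') \<cdot> V z a)" by simp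
  then have ex: "p \<cdot> ((p' \<cdot> k') \<cdot> q) = r z \<cdot> (a \<cdot> r' y)"
    using pN N_subset[OF inN] V ry rz aS unfolding q_def by (metis assoc closed)
  have uniq: "n = p' \<cdot> k'" if n: "n \<in> N e" "p \<cdot> (n \<cdot> q) = r z \<cdot> (a \<cdot> r' y)" for n
  proof (rule N_cancel_right[OF eE q n(1) inN], rule N_cancel_left[OF eE p])
    show "p \<cdot> (n \<cdot> q) = p \<cdot> ((p' \<cdot> k') \<cdot> q)" using n(2) ex by (simp only:)
  qed (use N_closed[OF eE _ q] n(1) inN in blast)+
  have C: "C z a = p' \<cdot> k'"
    unfolding C_def e_def[symmetric] y_def[symmetric] p_def[symmetric] q_def[symmetric]
    by (rule the_equality) (use ex inN uniq in blast)+
  show "C z a \<in> N e" using C inN by simp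
  show "r z \<cdot> a = (r z \<cdot> W z a) \<cdot> (C z a \<cdot> V z a)" using left C p_def by simp
  show "C z a = n" if "n \<in> N e"
    "(r z \<cdot> W z a) \<cdot> (n \<cdot> (V z a \<cdot> r' y)) = r z \<cdot> (a \<cdot> r' y)"
  proof -
    have "n = p' \<cdot> k'" by (rule uniq) (use that in \<open>simp_all only: p_def q_def\<close>)
    then show ?thesis using C by simp
  qed
  \<comment> \<open>Both sides equal \<open>r z \<cdot> (a \<cdot> r' y)\<close>; cancelling
    \<open>p\<close> expresses \<open>l'\<close> by \<open>C z a\<close> and
    \<open>q\<close>.\<close>
  have "p \<cdot> l' = p \<cdot> (C z a \<cdot> q)"
    using ex C ar W rz l' aS ry by (simp add: p_def N_subset)
  then have "l' = C z a \<cdot> q"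
    using N_cancel_left[OF eE p] l' N_closed[OF eE _ q] C inN by simp
  then show "a \<cdot> r' y = W z a \<cdot> (C z a \<cdot> (V z a \<cdot> r' y))"
    using ar q_def by simp
qed

text \<open>With \<open>y = z \<odot> \<pi> a\<close>, both \<open>r z \<cdot> a\<close> and
  \<open>r y\<close> lie over \<open>y\<close>, so by \<open>left_translates\<close> their products
  with \<open>b\<close> share an orbit, and \<open>V\<close> sees only \<open>b\<close>. Dually
  \<open>W\<close> sees only \<open>a\<close>. What remains is the Rees product formula for
  \<open>C\<close>.\<close>

lemma coordinates_mult:
  assumes z: "z \<in> T" and S: "a \<in> S" "b \<in> S" and ab: "arrow z (a \<cdot> b)"
  shows "W z (a \<cdot> b) = W z a" "V z (a \<cdot> b) = V (z \<odot> \<pi> a) b"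
    "V z a \<cdot> W (z \<odot> \<pi> a) b \<in> N (z \<odot> inv z)"
    "C z (a \<cdot> b) = C z a \<cdot> ((V z a \<cdot> W (z \<odot> \<pi> a) b) \<cdot> C (z \<odot> \<pi> a) b)"
proof -
  define y e where "y = z \<odot> \<pi> a" and "e = z \<odot> inv z"
  define x where "x = y \<odot> \<pi> b"
  note arr = arrow_mult[OF z S ab, folded y_def]
  have T: "y \<in> T" "x \<in> T" using z S by (auto simp: x_def y_def)
  have eE: "e \<in> E" using z by (simp add: e_def)
  note \<epsilon> = \<epsilon>[OF eE]
  have ye: "y \<odot> inv y = e" using arrow_target[OF arr(1)] by (simp add: y_def e_def)
  have xe: "x \<odot> inv x = e" using arrow_target[OF arr(2)] ye by (simp add: x_def)
  have bx: "\<pi> b \<odot> inv x = inv y" using arrow_back[OF arr(2)] by (simp add: x_def)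
  have ay: "\<pi> a \<odot> inv y = inv z" using arrow_back[OF arr(1)] by (simp add: y_def)
  have zab: "z \<odot> \<pi> (a \<cdot> b) = x" using z S by (simp add: x_def y_def)
  note rz = r[OF z, folded e_def] and ry = r[OF T(1), unfolded ye]
    and r'y = r'[OF T(1), unfolded ye] and r'x = r'[OF T(2), unfolded xe]
  note A = coordinates[OF arr(1), folded y_def e_def] and B = coordinates[OF arr(2), folded x_def, unfolded ye]
    and AB = coordinates[OF ab, unfolded zab, folded e_def]
  have "\<exists>n\<in>S. \<pi> n = \<pi> (\<epsilon> e) \<and> \<epsilon> e \<cdot> n = n \<and> n \<cdot> \<epsilon> e = n \<and> (r z \<cdot> a) \<cdot> b = n \<cdot> (r y \<cdot> b)"
    using rz ry \<epsilon> S ye arr(2) assocL[of "\<epsilon> e" "r z" a]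
    by (intro left_translates[where y = y]) (auto simp: arrow_def y_def)
  then obtain n where n: "n \<in> N e" "r z \<cdot> (a \<cdot> b) = n \<cdot> (r y \<cdot> b)"
    using \<epsilon> rz S by (auto simp: N_def)
  show Vab: "V z (a \<cdot> b) = V (z \<odot> \<pi> a) b"
    unfolding V_def y_def[symmetric]
    using n ry S xe \<epsilon> assocL[of "\<epsilon> e" "r y" b]
    by (intro left_rep_cong[where e = e and n = n]) (auto simp: x_def[symmetric])
  have tt: "(inv (\<pi> a) \<odot> \<pi> a) \<odot> inv y = inv y"
  proof -
    have "inv (y \<odot> (inv (\<pi> a) \<odot> \<pi> a)) = (inv (\<pi> a) \<odot> \<pi> a) \<odot> inv y"
      using T S by (simp add: inv_mult_distrib del: T_assoc)
    moreover have "y \<odot> (inv (\<pi> a) \<odot> \<pi> a) = y" using z S by (simp add: y_def)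
    ultimately show ?thesis by simp
  qed
  have "\<exists>n\<in>S. \<pi> n = \<pi> (\<epsilon> e) \<and> \<epsilon> e \<cdot> n = n \<and> n \<cdot> \<epsilon> e = n \<and> a \<cdot> (b \<cdot> r' x) = (a \<cdot> r' y) \<cdot> n"
    using r'x r'y \<epsilon> S T ye bx tt by (intro right_translates[where y = "inv y"]) auto
  then obtain n' where n': "n' \<in> N e" "a \<cdot> b \<cdot> r' x = a \<cdot> r' y \<cdot> n'"
    using \<epsilon> r'x S by (auto simp: N_def)
  show Wab: "W z (a \<cdot> b) = W z a"
    unfolding W_def y_def[symmetric] zab
    using n' r'y S ay \<epsilon> z e_def
    by (intro right_rep_cong[where e = e and n = n']) auto
  have "V z a \<cdot> W y b \<in> N e"
    using A(1-6) B(1-6) ye \<epsilon> assocL[of "\<epsilon> e" "V z a" "W y b"] by (auto simp: N_def)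
  then show VW: "V z a \<cdot> W (z \<odot> \<pi> a) b \<in> N (z \<odot> inv z)" by (simp add: y_def e_def)
  note NN = N_subset[OF C_N[OF arr(1)]] N_subset[OF C_N[OF arr(2)]]
  have "C z (a \<cdot> b) = C z a \<cdot> ((V z a \<cdot> W y b) \<cdot> C y b)"
  \<comment> \<open>\<open>AB(10)\<close> is the uniqueness of \<open>C\<close>. The product is
    split between \<open>a\<close> and \<open>b\<close>, using the left factorization of the first
    and the right factorization of the second.\<close>
  proof (rule AB(10))
    show "C z a \<cdot> ((V z a \<cdot> W y b) \<cdot> C y b) \<in> N e"
      using A(7) B(7) VW N_closed[OF eE] by (simp add: y_def e_def)
    have "r z \<cdot> (a \<cdot> b \<cdot> r' x) = (r z \<cdot> a) \<cdot> (b \<cdot> r' x)"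
      using rz S r'x by simp
    also have "\<dots> = ((r z \<cdot> W z a) \<cdot> (C z a \<cdot> V z a)) \<cdot> (W y b \<cdot> (C y b \<cdot> (V y b \<cdot> r' x)))"
      using A(8) B(9) by simp
    finally show "r z \<cdot> W z (a \<cdot> b) \<cdot> (C z a \<cdot> (V z a \<cdot> W y b \<cdot> C y b) \<cdot> (V z (a \<cdot> b) \<cdot> r' x)) =
        r z \<cdot> (a \<cdot> b \<cdot> r' x)"
      unfolding Wab Vab y_def[symmetric]
      using rz A(1,4) B(1,4) NN r'x by simp
  qed
  then show "C z (a \<cdot> b) = C z a \<cdot> ((V z a \<cdot> W (z \<odot> \<pi> a) b) \<cdot> C (z \<odot> \<pi> a) b)"
    by (simp add: y_def)
qed

text \<open>The equation on the right puts \<open>b\<close> into \<open>a \<cdot> S\<close>, so the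
  idempotent \<open>g = a \<cdot> a'\<close> fixes both \<open>a\<close> and \<open>b\<close> from
  the left. The local group at \<open>g\<close> then allows cancelling \<open>x\<close> in the
  equation on the left.\<close>

lemma translations_separate:
  assumes S: "a \<in> S" "b \<in> S" "x \<in> S" "x' \<in> S" and \<pi>: "\<pi> a = t" "\<pi> b = t" "\<pi> x = t \<odot> inv t" "\<pi> x' = inv t"
    and eq: "x \<cdot> a = x \<cdot> b" "a \<cdot> x' = b \<cdot> x'"
  shows "a = b"
proof -
  obtain a' where a': "a' \<in> S" "a \<cdot> (a' \<cdot> a) = a" "a' \<cdot> (a \<cdot> a') = a'" "\<pi> a' = inv t"
    using inverse_over S \<pi> by metis
  obtain b' where b': "b' \<in> S" "b \<cdot> (b' \<cdot> b) = b" "b' \<cdot> (b \<cdot> b') = b'" "\<pi> b' = inv t"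
    using inverse_over S \<pi> by metis
  define g where "g = a \<cdot> a'"
  define f where "f = b' \<cdot> b"
  have g: "g \<in> S" "g \<cdot> g = g" "\<pi> g = t \<odot> inv t" "g \<cdot> a = a"
    and f: "f \<in> S" "f \<cdot> f = f" "\<pi> f = inv t \<odot> t" "b \<cdot> f = b"
    using S \<pi> a' b' by (auto simp: g_def f_def)
  obtain s where s: "s \<in> S" "f \<cdot> ((x' \<cdot> b) \<cdot> s) = f"
    using local_group[of f "x' \<cdot> b"] f S \<pi> by auto
  have "b = b \<cdot> (f \<cdot> ((x' \<cdot> b) \<cdot> s))" using s f by simp
  also have "\<dots> = (b \<cdot> f) \<cdot> ((x' \<cdot> b) \<cdot> s)" using s f S by (intro assocL) auto
  also have "\<dots> = (b \<cdot> x') \<cdot> (b \<cdot> s)" using f s S by simp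
  also have "\<dots> = a \<cdot> (x' \<cdot> (b \<cdot> s))" using eq(2)[symmetric] s S by simp
  finally have gb: "g \<cdot> b = b" using g S s by (metis assoc closed)
  obtain s where s: "s \<in> S" "s \<cdot> (x \<cdot> g) = g"
    using local_group[of g x] g S \<pi> by auto
  have "g \<cdot> a = s \<cdot> (x \<cdot> (g \<cdot> a))" "g \<cdot> b = s \<cdot> (x \<cdot> (g \<cdot> b))"
    using s g(1) S by (metis assoc closed)+
  then show ?thesis using eq g(4) gb by simp
qed

text \<open>At this \<open>z\<close> the arrow ends at \<open>t\<close>, and the coordinates
  determine both \<open>r z \<cdot> a\<close> and \<open>a \<cdot> r' t\<close>.\<close>

lemma coordinates_separate:
  assumes S: "a \<in> S" "b \<in> S" and t: "\<pi> a = t" "\<pi> b = t" and z: "z = t \<odot> inv t"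
    and eq: "W z a = W z b" "V z a = V z b" "C z a = C z b"
  shows "a = b"
proof -
  have T: "t \<in> T" "z \<in> T" using assms by auto
  have arr: "arrow z a" "arrow z b" using S t T z by (auto simp: arrow_def)
  have zt: "z \<odot> t = t" "z \<odot> inv z = t \<odot> inv t" using T by (auto simp: z inv_mult_distrib)
  show ?thesis
  proof (rule translations_separate[OF S _ _ t])
    show "r z \<in> S" "\<pi> (r z) = t \<odot> inv t" using r[OF T(2)] z by auto
    show "r' t \<in> S" "\<pi> (r' t) = inv t" using r'[OF T(1)] by auto
    show "r z \<cdot> a = r z \<cdot> b" using C_left[OF arr(1)] C_left[OF arr(2)] eq by simp
    show "a \<cdot> r' t = b \<cdot> r' t" using C_right[OF arr(1)] C_right[OF arr(2)] eq t zt by simp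
  qed
qed

end

section \<open>The embedding\<close>

context cs_extension begin

section \<open>The semigroup K, the action, and the embedding\<close>

lemma group_on_N:
  assumes "e \<in> E"
  shows "group_on (N e) (\<cdot>) (\<epsilon> e)"
  unfolding group_on_def semigroup_def
  using assms by (auto simp: N_closed \<epsilon>_in_N N_subset N_unit intro: N_inverse)

text \<open>The functions from \<open>T\<close> to a Rees matrix semigroup \<open>L\<close>,
  regrouped as a single Rees matrix semigroup. \<open>L\<close> has index sets \<open>S\<close> and
  \<open>S\<close> and the product of all \<open>N e\<close> as its group, so the outer coordinates
  are shared by all \<open>e\<close>.\<close>

definition K :: "(('t \<Rightarrow> 'a) \<times> ('t \<times> 't \<Rightarrow> 'a) \<times> ('t \<Rightarrow> 'a)) set" where
  "K = (T \<rightarrow>\<^sub>E S) \<times> (\<Pi>\<^sub>E i\<in>T \<times> E. N (snd i)) \<times> (T \<rightarrow>\<^sub>E S)"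

text \<open>The entry at \<open>(x, e)\<close> only matters when the two arrows meet at an object in the
  \<open>\<R>\<close>-class of \<open>e\<close>; there the product lies in \<open>N e\<close>, and the value \<open>\<epsilon> e\<close> elsewhere is arbitrary.\<close>

definition sandwich :: "('t \<Rightarrow> 'a) \<Rightarrow> ('t \<Rightarrow> 'a) \<Rightarrow> 't \<times> 't \<Rightarrow> 'a" where
  "sandwich \<beta> \<alpha> = (\<lambda>i\<in>T \<times> E. if \<beta> (fst i) \<cdot> \<alpha> (fst i) \<in> N (snd i) then \<beta> (fst i) \<cdot> \<alpha> (fst i) else \<epsilon> (snd i))"

definition mK where "mK = rees (\<lambda>g h. \<lambda>i\<in>T \<times> E. g i \<cdot> h i) sandwich"

definition act :: "'t \<Rightarrow> ('t \<Rightarrow> 'a) \<times> ('t \<times> 't \<Rightarrow> 'a) \<times> ('t \<Rightarrow> 'a) \<Rightarrow>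
    ('t \<Rightarrow> 'a) \<times> ('t \<times> 't \<Rightarrow> 'a) \<times> ('t \<Rightarrow> 'a)" where
  "act u = (\<lambda>(\<alpha>, g, \<beta>).
     (\<lambda>x\<in>T. \<alpha> (x \<odot> u), \<lambda>i\<in>T \<times> E. g (fst i \<odot> u, snd i), \<lambda>x\<in>T. \<beta> (x \<odot> u)))"

text \<open>A function on \<open>T\<close> needs a value at every \<open>x\<close>, also where
  \<open>a\<close> is no arrow; there \<open>x\<close> is replaced by a restriction at which
  \<open>a\<close> is one. This also makes the first component of \<open>\<psi> a\<close> invariant
  under the idempotent of \<open>\<pi> a\<close>.\<close>

definition source :: "'t \<Rightarrow> 'a \<Rightarrow> 't" where "source x a = x \<odot> (\<pi> a \<odot> inv (\<pi> a))"

text \<open>Outside the \<R>-class of \<open>e\<close> the group coordinate is the unit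
  \<open>\<epsilon> e\<close>, which agrees with the default of \<open>sandwich\<close>, so that
  products are respected there too.\<close>

definition \<psi> :: "'a \<Rightarrow> (('t \<Rightarrow> 'a) \<times> ('t \<times> 't \<Rightarrow> 'a) \<times> ('t \<Rightarrow> 'a)) \<times> 't" where
  "\<psi> a = ((\<lambda>x\<in>T. W (source x a) a,
     \<lambda>i\<in>T \<times> E. (let z = source (fst i) a in if z \<odot> inv z = snd i then C z a else \<epsilon> (snd i)),
     \<lambda>x\<in>T. V (source x a) a), \<pi> a)"

lemma completely_simple_K: "completely_simple K mK"
  unfolding K_def mK_def
proof (rule completely_simple_rees)
  show "group_on (\<Pi>\<^sub>E i\<in>T \<times> E. N (snd i)) (\<lambda>g h. \<lambda>i\<in>T \<times> E. g i \<cdot> h i) (\<lambda>i\<in>T \<times> E. \<epsilon> (snd i))"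
    by (rule group_on_PiE) (auto intro: group_on_N)
  show "(T \<rightarrow>\<^sub>E S) \<noteq> {}" "(T \<rightarrow>\<^sub>E S) \<noteq> {}"
    using \<pi>_surj by (auto simp: PiE_eq_empty_iff)
  show "sandwich \<beta> \<alpha> \<in> (\<Pi>\<^sub>E i\<in>T \<times> E. N (snd i))" for \<beta> \<alpha>
    by (auto simp: sandwich_def \<epsilon>_in_N)
qed

lemma left_action_K: "left_action T (\<odot>) K mK act"
  unfolding left_action_def endomorphism_def
proof (intro conjI ballI)
  fix t k assume t: "t \<in> T" and k: "k \<in> K"
  show "act t k \<in> K" using t k by (auto simp: K_def act_def PiE_iff)
  fix k' assume k': "k' \<in> K"
  show "act t (mK k k') = mK (act t k) (act t k')"
    using t k k' by (auto simp: K_def act_def mK_def rees_def sandwich_def intro!: restrict_ext)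
next
  fix t u k assume "t \<in> T" "u \<in> T" "k \<in> K"
  then show "act (t \<odot> u) k = act t (act u k)"
    by (auto simp: K_def act_def intro!: restrict_ext)
qed

lemma arrow_source: "x \<in> T \<Longrightarrow> a \<in> S \<Longrightarrow> arrow (source x a) a"
  by (simp add: arrow_def source_def)

lemma source_arrow: "arrow z a \<Longrightarrow> source z a = z"
  by (simp add: arrow_def source_def)

lemma \<psi>_carrier:
  assumes a: "a \<in> S"
  shows "\<psi> a \<in> lsd_carrier K T (\<odot>) act"
proof -
  have "fst (\<psi> a) \<in> K"
    using arrow_source[OF _ a] W_S(1) V_S(1) C_N \<epsilon>_in_N
    by (auto simp: \<psi>_def K_def Let_def)
  moreover have "act (\<pi> a \<odot> inv (\<pi> a)) (fst (\<psi> a)) = fst (\<psi> a)"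
    using a by (auto simp: \<psi>_def act_def source_def Let_def intro!: restrict_ext)
  ultimately show ?thesis
    using a by (simp add: lsd_carrier_def \<psi>_def inv_def[symmetric])
qed

text \<open>In the product, \<open>act d\<close> evaluates the first factor at
  \<open>x \<odot> d\<close> and \<open>act t\<close> the second at \<open>x \<odot> t\<close>. The
  source of \<open>a\<close> at \<open>x \<odot> d\<close> is \<open>x \<odot> d\<close> itself, and
  that of \<open>b\<close> at \<open>x \<odot> t\<close> is the target of this arrow, so
  \<open>coordinates_mult\<close> applies at \<open>x \<odot> d\<close>.\<close>

lemma \<psi>_mult:
  assumes a: "a \<in> S" and b: "b \<in> S"
  shows "\<psi> (a \<cdot> b) = lsd_mult mK T (\<odot>) act (\<psi> a) (\<psi> b)"
proof -
  define t u where "t = \<pi> a" and "u = \<pi> b"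
  have T: "t \<in> T" "u \<in> T" and ab: "\<pi> (a \<cdot> b) = t \<odot> u" using a b by (auto simp: t_def u_def)
  define d where "d = t \<odot> u \<odot> inv (t \<odot> u)"
  have dT: "d \<in> T" using T by (simp add: d_def)
  have src: "source x (a \<cdot> b) = x \<odot> d" for x by (simp add: source_def ab d_def)
  have arr: "arrow (x \<odot> d) (a \<cdot> b)" if "x \<in> T" for x
    using arrow_source[OF that, of "a \<cdot> b"] a b src by simp
  have src_a: "source (x \<odot> d) a = x \<odot> d" if "x \<in> T" for x
    using arrow_mult(1)[OF _ a b arr] that dT source_arrow by simp
  have src_b: "source (x \<odot> t) b = (x \<odot> d) \<odot> \<pi> a" if x: "x \<in> T" for x
  proof -
    have c: "(u \<odot> inv u) \<odot> (inv t \<odot> t) = (inv t \<odot> t) \<odot> (u \<odot> inv u)"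
      using T by (intro idem_commute) auto
    have "(x \<odot> d) \<odot> t = x \<odot> (t \<odot> ((u \<odot> inv u) \<odot> (inv t \<odot> t)))"
      using T x by (simp add: d_def inv_mult_distrib)
    also have "\<dots> = x \<odot> ((t \<odot> (inv t \<odot> t)) \<odot> (u \<odot> inv u))"
      unfolding c using T x by (simp del: inv_mult1)
    also have "\<dots> = (x \<odot> t) \<odot> (u \<odot> inv u)" using T x by simp
    finally show ?thesis by (simp add: source_def t_def u_def)
  qed
  note M = coordinates_mult[OF _ a b arr]
  have 1: "W (x \<odot> d) (a \<cdot> b) = W (source (x \<odot> d) a) a" if "x \<in> T" for x
    using M(1) that dT src_a by simp
  have 2: "V (x \<odot> d) (a \<cdot> b) = V (source (x \<odot> t) b) b" if "x \<in> T" for x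
    using M(2) that dT src_b by simp
  define gc where "gc c z e = (if z \<odot> inv z = e then C z c else \<epsilon> e)" for c z e
  have 3: "gc (a \<cdot> b) (x \<odot> d) e =
      gc a (x \<odot> d) e \<cdot> (if V (x \<odot> d) a \<cdot> W ((x \<odot> d) \<odot> \<pi> a) b \<in> N e
         then V (x \<odot> d) a \<cdot> W ((x \<odot> d) \<odot> \<pi> a) b else \<epsilon> e) \<cdot> gc b ((x \<odot> d) \<odot> \<pi> a) e"
    if x: "x \<in> T" and e: "e \<in> E" for x e
  proof -
    define z where "z = x \<odot> d"
    have z: "z \<in> T" "arrow z (a \<cdot> b)" using x dT arr by (auto simp: z_def)
    note arrows = arrow_mult[OF z(1) a b z(2)]
    have target: "(z \<odot> \<pi> a) \<odot> inv (z \<odot> \<pi> a) = z \<odot> inv z" using arrow_target arrows by blast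
    note M = coordinates_mult[OF z(1) a b z(2)]
    note NN = N_subset(1)[OF C_N[OF arrows(1)]] N_subset(1)[OF C_N[OF arrows(2)]] N_subset(1)[OF M(3)]
    show ?thesis
      unfolding z_def[symmetric]
    proof (cases "z \<odot> inv z = e")
      case True
      then show "gc (a \<cdot> b) z e =
        gc a z e \<cdot> (if V z a \<cdot> W (z \<odot> \<pi> a) b \<in> N e then V z a \<cdot> W (z \<odot> \<pi> a) b else \<epsilon> e) \<cdot> gc b (z \<odot> \<pi> a) e"
        unfolding gc_def target using M(3,4) assoc[OF NN(1,3,2)] by simp
    next
      case False
      \<comment> \<open>The product lies over \<open>z \<odot> inv z\<close>, which differs from
        \<open>e\<close>; all three group factors are therefore the default
        \<open>\<epsilon> e\<close>.\<close>
      then have "V z a \<cdot> W (z \<odot> \<pi> a) b \<notin> N e" using M(3) by (auto simp: N_def)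
      then show "gc (a \<cdot> b) z e =
        gc a z e \<cdot> (if V z a \<cdot> W (z \<odot> \<pi> a) b \<in> N e then V z a \<cdot> W (z \<odot> \<pi> a) b else \<epsilon> e) \<cdot> gc b (z \<odot> \<pi> a) e"
        unfolding gc_def target using False \<epsilon>[OF e] by simp
    qed
  qed
  have \<psi>: "\<psi> c = ((\<lambda>x\<in>T. W (source x c) c, \<lambda>i\<in>T \<times> E. gc c (source (fst i) c) (snd i),
      \<lambda>x\<in>T. V (source x c) c), \<pi> c)" for c
    by (simp add: \<psi>_def gc_def Let_def)
  have "fst (lsd_mult mK T (\<odot>) act (\<psi> a) (\<psi> b)) = mK (act d (fst (\<psi> a))) (act t (fst (\<psi> b)))"
    by (simp add: lsd_mult_def Let_def \<psi>_def inv_def d_def t_def u_def)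
  also have "\<dots> = fst (\<psi> (a \<cdot> b))"
    unfolding \<psi> mK_def act_def rees_def sandwich_def
    using T dT 1 2 3 src_a src_b
    by (auto simp: src intro!: restrict_ext)
  finally show ?thesis
    using ab by (simp add: prod_eq_iff lsd_mult_def Let_def \<psi>_def t_def u_def)
qed

lemma \<psi>_inj: "inj_on \<psi> S"
proof (rule inj_onI)
  fix a b assume S: "a \<in> S" "b \<in> S" and eq: "\<psi> a = \<psi> b"
  define t where "t = \<pi> a"
  define z where "z = t \<odot> inv t"
  have t: "\<pi> a = t" "\<pi> b = t" "t \<in> T" using S eq by (auto simp: \<psi>_def t_def)
  have zT: "z \<in> T" and src: "source z a = z" "source z b = z" using t by (auto simp: source_def z_def)
  have iE: "z \<odot> inv z \<in> E" using zT by simp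
  have "(\<lambda>x\<in>T. W (source x a) a) z = (\<lambda>x\<in>T. W (source x b) b) z"
    "(\<lambda>x\<in>T. V (source x a) a) z = (\<lambda>x\<in>T. V (source x b) b) z"
    "fst (snd (fst (\<psi> a))) (z, z \<odot> inv z) = fst (snd (fst (\<psi> b))) (z, z \<odot> inv z)"
    using eq by (auto simp: \<psi>_def)
  then have "W z a = W z b" "V z a = V z b" "C z a = C z b"
    using zT src iE by (simp_all add: \<psi>_def Let_def)
  then show "a = b" using coordinates_separate S t z_def by blast
qed

lemma lsd_embedding_\<psi>: "lsd_embedding S (\<cdot>) T (\<odot>) K mK act \<psi>"
  using completely_simple_K left_action_K \<psi>_carrier \<psi>_mult \<psi>_inj
  by (auto simp: lsd_embedding_def)

text \<open>The three functions are coded by their graphs. \<open>rep\<close> turns elements of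
  \<open>T\<close> into elements of \<open>S\<close>, and the list lengths 2, 3 and 4, reached by
  repeating an entry, keep the graphs apart.\<close>

definition encode :: "('t \<Rightarrow> 'a) \<times> ('t \<times> 't \<Rightarrow> 'a) \<times> ('t \<Rightarrow> 'a) \<Rightarrow> 'a list set" where
  "encode = (\<lambda>(\<alpha>, g, \<beta>). (\<lambda>x. [rep x, \<alpha> x]) ` T \<union> (\<lambda>x. [rep x, rep x, \<beta> x]) ` T \<union>
     (\<lambda>i. [rep (fst i), rep (snd i), rep (snd i), g i]) ` (T \<times> E))"

lemma inj_on_encode: "inj_on encode K"
proof (rule inj_onI)
  fix k k' assume k: "k \<in> K" "k' \<in> K" and eq: "encode k = encode k'"
  obtain \<alpha> g \<beta> \<alpha>' g' \<beta>' where kk: "k = (\<alpha>, g, \<beta>)" "k' = (\<alpha>', g', \<beta>')" by (cases k; cases k')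
  have 1: "\<alpha> x = \<alpha>' x" "\<beta> x = \<beta>' x" if "x \<in> T" for x
  proof -
    have "[rep x, \<alpha> x] \<in> encode k" "[rep x, rep x, \<beta> x] \<in> encode k"
      using that by (auto simp: kk encode_def)
    then show "\<alpha> x = \<alpha>' x" "\<beta> x = \<beta>' x"
      unfolding eq using that by (auto simp: kk encode_def rep_eq_iff)
  qed
  have 2: "g i = g' i" if "i \<in> T \<times> E" for i
  proof -
    have "[rep (fst i), rep (snd i), rep (snd i), g i] \<in> encode k"
      using that unfolding kk encode_def by simp
    then show "g i = g' i"
      unfolding eq using that by (auto simp: kk encode_def rep_eq_iff E_def)
  qed
  have mem: "\<alpha> \<in> T \<rightarrow>\<^sub>E S" "\<alpha>' \<in> T \<rightarrow>\<^sub>E S" "\<beta> \<in> T \<rightarrow>\<^sub>E S" "\<beta>' \<in> T \<rightarrow>\<^sub>E S"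
    "g \<in> (\<Pi>\<^sub>E i\<in>T \<times> E. N (snd i))" "g' \<in> (\<Pi>\<^sub>E i\<in>T \<times> E. N (snd i))"
    using k by (simp_all add: kk K_def)
  have "\<alpha> = \<alpha>'" by (rule PiE_ext[OF mem(1,2)]) (rule 1)
  moreover have "\<beta> = \<beta>'" by (rule PiE_ext[OF mem(3,4)]) (rule 1)
  moreover have "g = g'" by (rule PiE_ext[OF mem(5,6)]) (rule 2)
  ultimately show "k = k'" by (simp add: kk)
qed

lemma lsd_embedding_list_set:
  "\<exists>(K :: 'a list set set) mK eps \<psi>. lsd_embedding S (\<cdot>) T (\<odot>) K mK eps \<psi> \<and> (\<forall>x. snd (\<psi> x) = \<pi> x)"
proof -
  obtain mK' eps' where
    "lsd_embedding S (\<cdot>) T (\<odot>) (encode ` K) mK' eps' (\<lambda>x. (encode (fst (\<psi> x)), snd (\<psi> x)))"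
    using lsd_embedding_image[OF lsd_embedding_\<psi> inj_on_encode] inv_closed[unfolded inv_def] T_closed
    by blast
  moreover have "snd (\<psi> x) = \<pi> x" for x by (simp add: \<psi>_def)
  ultimately show ?thesis by (intro exI conjI) auto
qed

end

section \<open>From the congruence to the projection onto the quotient\<close>

lemma cs_extension_quotient:
  assumes sg: "semigroup S m" and li: "locally_inverse S m" and ic: "inverse_congruence S m \<rho>"
    and cs: "\<forall>e\<in>idempotents S m. completely_simple (\<rho> `` {e}) m"
  shows "cs_extension (S // \<rho>) (quot_mult \<rho> m) S m (\<lambda>x. \<rho> `` {x})"
proof -
  have cl: "m x y \<in> S" if "x \<in> S" "y \<in> S" for x y using sg that by (auto simp: semigroup_def)
  have as: "m (m x y) z = m x (m y z)" if "x \<in> S" "y \<in> S" "z \<in> S" for x y z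
    using sg that by (auto simp: semigroup_def)
  have eqv: "equiv S \<rho>" and cong: "\<And>a b c. (a, b) \<in> \<rho> \<Longrightarrow> c \<in> S \<Longrightarrow> (m c a, m c b) \<in> \<rho> \<and> (m a c, m b c) \<in> \<rho>"
    and isg: "inverse_semigroup (S // \<rho>) (quot_mult \<rho> m)"
    using ic by (auto simp: inverse_congruence_def congruence_def)
  have cls_eq: "\<rho> `` {x} = \<rho> `` {y} \<longleftrightarrow> (x, y) \<in> \<rho>" if "x \<in> S" "y \<in> S" for x y
    using eqv that by (simp add: eq_equiv_class_iff)
  have sub: "(x, y) \<in> \<rho> \<Longrightarrow> x \<in> S \<and> y \<in> S" for x y
    using eqv by (auto simp: equiv_def refl_on_def)
  have trans: "(x, y) \<in> \<rho> \<Longrightarrow> (y, z) \<in> \<rho> \<Longrightarrow> (x, z) \<in> \<rho>" for x y z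
    using eqv by (auto simp: equiv_def trans_def)
  have sym: "(x, y) \<in> \<rho> \<Longrightarrow> (y, x) \<in> \<rho>" for x y
    using eqv by (auto simp: equiv_def sym_def)
  have qm: "\<rho> `` {m x y} = quot_mult \<rho> m (\<rho> `` {x}) (\<rho> `` {y})" if "x \<in> S" "y \<in> S" for x y
  proof -
    define x' where "x' = (SOME z. z \<in> \<rho> `` {x})"
    define y' where "y' = (SOME z. z \<in> \<rho> `` {y})"
    have "x' \<in> \<rho> `` {x}" "y' \<in> \<rho> `` {y}"
      unfolding x'_def y'_def using eqv that by (metis equiv_class_self someI)+
    then have r: "(x, x') \<in> \<rho>" "(y, y') \<in> \<rho>" by auto
    then have "(m x y, m x' y') \<in> \<rho>" using trans cong sub by meson
    then have "\<rho> `` {m x y} = \<rho> `` {m x' y'}" using cls_eq sub by blast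
    then show ?thesis by (simp add: quot_mult_def x'_def y'_def)
  qed
  have reg: "\<exists>x\<in>S. m a (m x a) = a" if "a \<in> S" for a
    using li that as by (fastforce simp: locally_inverse_def regular_def)
  have inverse: "\<exists>b\<in>S. m a (m b a) = a \<and> m b (m a b) = b" if a: "a \<in> S" for a
  proof -
    obtain x where x: "x \<in> S" "m a (m x a) = a" using reg a by blast
    have axa: "m a (m x (m a z)) = m a z" if "z \<in> S" for z using x a that as cl by metis
    show ?thesis
      using x a cl as axa by (intro bexI[of _ "m x (m a x)"]) simp_all
  qed
  show ?thesis
  proof (intro cs_extension.intro cs_extension_axioms.intro)
    show "inverse_sgp (S // \<rho>) (quot_mult \<rho> m)" using isg by unfold_locales
    show "\<rho> `` {x} \<in> S // \<rho>" if "x \<in> S" for x using that by (rule quotientI)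
    show "\<exists>x\<in>S. \<rho> `` {x} = t" if "t \<in> S // \<rho>" for t using that by (auto elim: quotientE)
  next
    fix t assume t: "t \<in> S // \<rho>" "quot_mult \<rho> m t t = t"
    obtain a where a: "a \<in> S" "t = \<rho> `` {a}" using t by (auto elim: quotientE)
    have aa: "(m a a, a) \<in> \<rho>" using t a qm[of a a] cls_eq[of "m a a" a] cl by simp
    \<comment> \<open>Lallement's argument: for an inverse \<open>x\<close> of \<open>a a\<close>,
      the element \<open>a x a\<close> is idempotent, and it is congruent to
      \<open>a a x a a = a a\<close>, hence to \<open>a\<close>.\<close>
    obtain x where x: "x \<in> S" "m (m a a) (m x (m a a)) = m a a" "m x (m (m a a) x) = x"
      using inverse[of "m a a"] a cl by auto
    have xx: "m x (m a (m a (m x z))) = m x z" if "z \<in> S" for z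
      using x a that as cl by metis
    let ?k = "m a (m x a)"
    have "m ?k ?k = ?k" using a x as cl xx by simp
    moreover have "(?k, a) \<in> \<rho>"
    proof -
      have "(m (m a a) (m x (m a a)), ?k) \<in> \<rho>"
        using cong[OF aa, of "m x (m a a)"] cong[OF cong[OF aa x(1), THEN conjunct1] a(1)] a x cl trans by meson
      then show ?thesis using x(2) aa trans sym by metis
    qed
    ultimately show "\<exists>k\<in>S. m k k = k \<and> \<rho> `` {k} = t"
      using a x cl cls_eq by (intro bexI[of _ ?k]) auto
  next
    fix k s assume k: "k \<in> S" "m k k = k" and s: "s \<in> S" "\<rho> `` {s} = \<rho> `` {k}"
    have P: "completely_simple (\<rho> `` {k}) m" using cs k by (auto simp: idempotents_def idem_def)
    have "k \<in> \<rho> `` {k}" "s \<in> \<rho> `` {k}" using equiv_class_self[OF eqv k(1)] equiv_class_self[OF eqv s(1)] s(2) by (simp_all only:)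
    from completely_simple_local_group[OF P this(1) k(2) this(2)]
    show "\<exists>s'\<in>S. \<rho> `` {s'} = \<rho> `` {k} \<and> m k s' = s' \<and> m s' k = s' \<and> m k (m s s') = k \<and> m s' (m s k) = k"
      using sub cls_eq sym by (metis Image_singleton_iff)
  next
    fix e g h assume e: "e \<in> S" "m e e = e" and g: "g \<in> S" "m g g = g" and h: "h \<in> S" "m h h = h"
      and le: "m e g = g" "m g e = g" "m e h = h" "m h e = h"
    interpret loc: inverse_sgp "local_submonoid S m e" m
      using li e by unfold_locales (auto simp: locally_inverse_def idempotents_def idem_def)
    have "g \<in> local_submonoid S m e" "h \<in> local_submonoid S m e"
      unfolding local_submonoid_def using g h le by force+
    then show "m g h = m h g" using loc.idem_commute g h by blast
  qed (use cl as qm inverse in auto)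
qed

theorem theorem3p1:
  fixes S :: "'a set" and m :: "'a \<Rightarrow> 'a \<Rightarrow> 'a" and \<rho> :: "('a \<times> 'a) set"
  assumes "semigroup S m"
    and "E_solid S m"
    and "locally_inverse S m"
    and "inverse_congruence S m \<rho>"
    and "\<forall>e\<in>idempotents S m. completely_simple (\<rho> `` {e}) m"
  shows "\<exists>(K :: 'a list set set) (mK :: 'a list set \<Rightarrow> 'a list set \<Rightarrow> 'a list set)
            (eps :: 'a set \<Rightarrow> 'a list set \<Rightarrow> 'a list set) (\<psi> :: 'a \<Rightarrow> 'a list set \<times> 'a set).
           completely_simple K mK \<and>
           left_action (S // \<rho>) (quot_mult \<rho> m) K mK eps \<and>
           \<psi> ` S \<subseteq> lsd_carrier K (S // \<rho>) (quot_mult \<rho> m) eps \<and>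
           inj_on \<psi> S \<and>
           (\<forall>x\<in>S. \<forall>y\<in>S. \<psi> (m x y) = lsd_mult mK (S // \<rho>) (quot_mult \<rho> m) eps (\<psi> x) (\<psi> y)) \<and>
           (\<forall>x\<in>S. \<forall>y\<in>S. snd (\<psi> x) = snd (\<psi> y) \<longleftrightarrow> (x, y) \<in> \<rho>)"
proof -
  have "equiv S \<rho>" using assms(4) by (simp add: inverse_congruence_def congruence_def)
  then have cls: "\<rho> `` {x} = \<rho> `` {y} \<longleftrightarrow> (x, y) \<in> \<rho>" if "x \<in> S" "y \<in> S" for x y
    using that by (simp add: eq_equiv_class_iff)
  from cs_extension.lsd_embedding_list_set[OF cs_extension_quotient[OF assms(1,3-5)]]
  obtain K :: "'a list set set" and mK eps \<psi> where
    "lsd_embedding S m (S // \<rho>) (quot_mult \<rho> m) K mK eps \<psi>" "\<forall>x. snd (\<psi> x) = \<rho> `` {x}"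
    by blast
  then show ?thesis
    unfolding lsd_embedding_def using cls by (intro exI[of _ K] exI[of _ mK] exI[of _ eps] exI[of _ \<psi>]) auto
qed

end
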